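(* Over $\mathbb{Q}$, the Schur algebra $S(2,d)$ is isomorphic with $\mathcal{B}_d$. The set of all $e^aH_1^bf^c$ with $a,b,c\ge0$ and $a+b+c\le d$ is a $\mathbb{Q}$-basis of $\mathcal{B}_d$, as is the set of all $f^aH_2^be^c$ with $a,b,c\ge0$ and $a+b+c\le d$.
   Context: Fix an integer $d\ge 0$. $\mathcal{B}_d$ is the associative $\mathbb{Q}$-algebra with $1$ generated by $e,f,H_1,H_2$ subject to the relations $H_1H_2=H_2H_1$, $H_1e-eH_1=e$, $H_1f-fH_1=-f$, $H_2e-eH_2=-e$, $H_2f-fH_2=f$, $ef-fe=H_1-H_2$, $H_1+H_2=d$, and $H_1(H_1-1)\cdots(H_1-d)=0$. Let $E=\mathbb{Q}^2$; the Schur algebra $S(2,d)$ is the image of the group algebra $\mathbb{Q}GL_2(\mathbb{Q})$ acting diagonally on $E^{\otimes d}$, equivalently the image of the differentiated representation $\rho_d:U(\mathfrak{gl}_2)\to\mathrm{End}(E^{\otimes d})$. *)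

theory Defs
  imports Complex_Main
begin

datatype gen = GE | GF | GH1 | GH2

text \<open>Elements of the free algebra: finitely supported functions from words to rat.\<close>
type_synonym fa = "gen list \<Rightarrow> rat"

definition fa_fin :: "fa set" where
  "fa_fin = {p. finite {w. p w \<noteq> 0}}"

definition fa_zero :: fa where "fa_zero = (\<lambda>w. 0)"
definition fa_add :: "fa \<Rightarrow> fa \<Rightarrow> fa" where "fa_add p q = (\<lambda>w. p w + q w)"
definition fa_diff :: "fa \<Rightarrow> fa \<Rightarrow> fa" where "fa_diff p q = (\<lambda>w. p w - q w)"
definition fa_smult :: "rat \<Rightarrow> fa \<Rightarrow> fa" where "fa_smult c p = (\<lambda>w. c * p w)"
definition fa_mult :: "fa \<Rightarrow> fa \<Rightarrow> fa" where
  "fa_mult p q = (\<lambda>w. \<Sum>i\<le>length w. p (take i w) * q (drop i w))"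
definition fa_word :: "gen list \<Rightarrow> fa" where
  "fa_word u = (\<lambda>w. if w = u then 1 else 0)"
definition fa_one :: fa where "fa_one = fa_word []"
definition fa_gen :: "gen \<Rightarrow> fa" where "fa_gen x = fa_word [x]"
definition fa_lincomb :: "'i set \<Rightarrow> ('i \<Rightarrow> rat) \<Rightarrow> ('i \<Rightarrow> fa) \<Rightarrow> fa" where
  "fa_lincomb T c m = (\<lambda>w. \<Sum>t\<in>T. c t * m t w)"

definition fa_comm :: "fa \<Rightarrow> fa \<Rightarrow> fa" where
  "fa_comm x y = fa_diff (fa_mult x y) (fa_mult y x)"

definition B_rels :: "nat \<Rightarrow> fa set" where
  "B_rels d = (let e = fa_gen GE; f = fa_gen GF; h1 = fa_gen GH1; h2 = fa_gen GH2 in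
     { fa_comm h1 h2,
       fa_diff (fa_comm h1 e) e,
       fa_add (fa_comm h1 f) f,
       fa_add (fa_comm h2 e) e,
       fa_diff (fa_comm h2 f) f,
       fa_diff (fa_comm e f) (fa_diff h1 h2),
       fa_diff (fa_add h1 h2) (fa_smult (of_nat d) fa_one),
       foldr (\<lambda>k acc. fa_mult (fa_diff h1 (fa_smult (of_nat k) fa_one)) acc) [0..<Suc d] fa_one })"

inductive_set B_ideal :: "nat \<Rightarrow> fa set" for d :: nat where
  rel: "r \<in> B_rels d \<Longrightarrow> r \<in> B_ideal d"
| zero: "fa_zero \<in> B_ideal d"
| add: "p \<in> B_ideal d \<Longrightarrow> q \<in> B_ideal d \<Longrightarrow> fa_add p q \<in> B_ideal d"
| smult: "p \<in> B_ideal d \<Longrightarrow> fa_smult c p \<in> B_ideal d"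
| mult: "p \<in> B_ideal d \<Longrightarrow> a \<in> fa_fin \<Longrightarrow> b \<in> fa_fin \<Longrightarrow> fa_mult (fa_mult a p) b \<in> B_ideal d"

text \<open>B_d is the quotient fa_fin / B_ideal d.  A family m indexed by T is a
  Q-basis of B_d iff the classes span and are linearly independent.\<close>

definition quot_basis :: "nat \<Rightarrow> 'i set \<Rightarrow> ('i \<Rightarrow> gen list) \<Rightarrow> bool" where
  "quot_basis d T m \<longleftrightarrow>
     (\<forall>p\<in>fa_fin. \<exists>c. fa_diff p (fa_lincomb T c (\<lambda>t. fa_word (m t))) \<in> B_ideal d) \<and>
     (\<forall>c. fa_lincomb T c (\<lambda>t. fa_word (m t)) \<in> B_ideal d \<longrightarrow> (\<forall>t\<in>T. c t = 0))"

definition triples :: "nat \<Rightarrow> (nat \<times> nat \<times> nat) set" where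
  "triples d = {(a, b, c). a + b + c \<le> d}"

definition mon_eHf :: "nat \<times> nat \<times> nat \<Rightarrow> gen list" where
  "mon_eHf t = (case t of (a, b, c) \<Rightarrow> replicate a GE @ replicate b GH1 @ replicate c GF)"

definition mon_fHe :: "nat \<times> nat \<times> nat \<Rightarrow> gen list" where
  "mon_fHe t = (case t of (a, b, c) \<Rightarrow> replicate a GF @ replicate b GH2 @ replicate c GE)"

text \<open>Basis of E^{\<otimes>d}: words of length d over {0,1}; endomorphisms are
  matrices indexed by such words (zero outside).\<close>
definition Wd :: "nat \<Rightarrow> nat list set" where
  "Wd d = {u. length u = d \<and> set u \<subseteq> {0, 1}}"

type_synonym mat = "nat list \<Rightarrow> nat list \<Rightarrow> rat"

definition mat_zero :: mat where "mat_zero = (\<lambda>u v. 0)"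
definition mat_add :: "mat \<Rightarrow> mat \<Rightarrow> mat" where "mat_add M N = (\<lambda>u v. M u v + N u v)"
definition mat_smult :: "rat \<Rightarrow> mat \<Rightarrow> mat" where "mat_smult c M = (\<lambda>u v. c * M u v)"
definition mat_mult :: "nat \<Rightarrow> mat \<Rightarrow> mat \<Rightarrow> mat" where
  "mat_mult d M N = (\<lambda>u v. if u \<in> Wd d \<and> v \<in> Wd d then \<Sum>w\<in>Wd d. M u w * N w v else 0)"
definition mat_one :: "nat \<Rightarrow> mat" where
  "mat_one d = (\<lambda>u v. if u \<in> Wd d \<and> v = u then 1 else 0)"

definition GL2 :: "(nat \<Rightarrow> nat \<Rightarrow> rat) set" where
  "GL2 = {g. g 0 0 * g 1 1 - g 0 1 * g 1 0 \<noteq> 0}"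

definition tensor_power :: "nat \<Rightarrow> (nat \<Rightarrow> nat \<Rightarrow> rat) \<Rightarrow> mat" where
  "tensor_power d g = (\<lambda>u v. if u \<in> Wd d \<and> v \<in> Wd d then \<Prod>i<d. g (u ! i) (v ! i) else 0)"

text \<open>S(2,d): image of the group algebra Q GL_2(Q), i.e. the Q-span of the tensor_power d g.\<close>
definition schur_algebra :: "nat \<Rightarrow> mat set" where
  "schur_algebra d = {M. \<exists>(n::nat) c g. (\<forall>i<n. g i \<in> GL2) \<and>
                          M = (\<lambda>u v. \<Sum>i<n. c i * tensor_power d (g i) u v)}"

definition alg_hom :: "nat \<Rightarrow> (fa \<Rightarrow> mat) \<Rightarrow> bool" where
  "alg_hom d \<phi> \<longleftrightarrow>
     (\<forall>p\<in>fa_fin. \<forall>q\<in>fa_fin. \<phi> (fa_add p q) = mat_add (\<phi> p) (\<phi> q)) \<and>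
     (\<forall>p\<in>fa_fin. \<forall>c. \<phi> (fa_smult c p) = mat_smult c (\<phi> p)) \<and>
     (\<forall>p\<in>fa_fin. \<forall>q\<in>fa_fin. \<phi> (fa_mult p q) = mat_mult d (\<phi> p) (\<phi> q)) \<and>
     \<phi> fa_one = mat_one d"

text \<open>B_d = fa_fin / B_ideal d is isomorphic to S(2,d): there is a homomorphism on the
  free algebra with kernel exactly B_ideal d and image exactly S(2,d).\<close>
definition B_iso_schur :: "nat \<Rightarrow> bool" where
  "B_iso_schur d \<longleftrightarrow> (\<exists>\<phi>. alg_hom d \<phi> \<and>
      {p \<in> fa_fin. \<phi> p = mat_zero} = B_ideal d \<and> \<phi> ` fa_fin = schur_algebra d)"

end

theory Submission
  imports Defs "HOL-Computational_Algebra.Formal_Power_Series" "HOL-Computational_Algebra.Polynomial"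
begin

text \<open>
  Spanning. Let \<open>F\<^sub>n\<close> be the image in \<open>B\<^sub>d\<close> of the words of length at most \<open>n\<close>. Words of length
  \<open>n\<close> with the same letters agree modulo \<open>F\<^sub>n\<^sub>-\<^sub>1\<close>, and one of \<open>H\<^sub>1\<close>, \<open>H\<^sub>2\<close> can be eliminated, so the
  monomials of degree \<open>n\<close> span \<open>F\<^sub>n\<close> modulo \<open>F\<^sub>n\<^sub>-\<^sub>1\<close>. The last relation puts \<open>H\<^sub>1\<close> to the power \<open>d + 1\<close>
  into \<open>F\<^sub>d\<close>. Since \<open>F\<^sub>d\<close> is stable under commutation with \<open>e\<close> and with \<open>f\<close>, repeated commutation
  puts every monomial of degree \<open>d + 1\<close> into \<open>F\<^sub>d\<close>, whence \<open>F\<^sub>d\<close> is everything.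

  Independence. A word in \<open>{0, 1}\<close> is determined by the set \<open>U\<close> of positions of its zeros. The
  matrix of \<open>e\<^sup>aH\<^sub>1\<^sup>bf\<^sup>c\<close> on tensor space vanishes at \<open>(U, V)\<close> if \<open>a < |U - V|\<close>, and for
  \<open>a = |U - V|\<close> it is \<open>a! c! |U \<inter> V|\<^sup>b\<close> if \<open>c = |V - U|\<close> and 0 otherwise. By descending induction on
  \<open>a\<close>, the coefficients in a linear relation are those of a polynomial in \<open>|U \<inter> V|\<close> with more roots
  than its degree. Independence in \<open>End(E\<^sup>d)\<close> gives both the bases and the kernel of the representation.

  Image. The entries of \<open>(1 + x e)\<close> acting on tensor space are polynomials in \<open>x\<close> of degree at most
  \<open>d\<close> with linear coefficient \<open>e\<close>, so interpolation writes \<open>e\<close> as a combination of group elements;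
  the same works for \<open>f\<close>, \<open>H\<^sub>1\<close>, \<open>H\<^sub>2\<close>. Conversely shears are truncated exponentials of \<open>e\<close> and \<open>f\<close>,
  diagonal elements are polynomials in \<open>H\<^sub>1\<close>, and these generate \<open>GL\<^sub>2\<close>.
\<close>

section \<open>The free algebra\<close>

lemma fa_mult_word_word: "fa_mult (fa_word u) (fa_word v) = fa_word (u @ v)"
proof
  fix w
  have "fa_word u (take i w) * fa_word v (drop i w) =
      (if i = length u then if w = u @ v then 1 else 0 else 0)" if "i \<le> length w" for i
  proof -
    have "take i w = u \<and> drop i w = v \<longleftrightarrow> i = length u \<and> w = u @ v"
      using that by (metis append_eq_conv_conj append_take_drop_id length_take min.absorb2)
    moreover have "fa_word u (take i w) * fa_word v (drop i w) =
        (if take i w = u \<and> drop i w = v then 1 else 0)"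
      by (simp add: fa_word_def)
    ultimately show ?thesis
      by simp
  qed
  then have "fa_mult (fa_word u) (fa_word v) w =
      (\<Sum>i\<le>length w. if i = length u then if w = u @ v then 1 else 0 else 0)"
    unfolding fa_mult_def by (intro sum.cong) simp_all
  then show "fa_mult (fa_word u) (fa_word v) w = fa_word (u @ v) w"
    by (simp add: fa_word_def)
qed

lemma fa_mult_assoc: "fa_mult (fa_mult p q) r = fa_mult p (fa_mult q r)"
proof
  fix w
  \<comment> \<open>Here i, m and l are the lengths of the three pieces of w. Both bracketings sum f
    over all cuts with i + m + l = \<open>length w\<close>, and the lemma on power series products
    exchanges the two orders of summation.\<close>
  define f where "f i m l = p (take i w) * q (take m (drop i w)) * r (drop (length w - l) w)" for i m l
  have "fa_mult (fa_mult p q) r w = (\<Sum>j=0..length w. \<Sum>i=0..j. f i (j - i) (length w - j))"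
    unfolding fa_mult_def f_def sum_distrib_right atLeast0AtMost
    by (intro sum.cong refl) (auto simp: min_def drop_take)
  also have "\<dots> = (\<Sum>j=0..length w. \<Sum>i=0..length w - j. f j i (length w - j - i))"
    by (rule fps_mult_assoc_lemma)
  also have "\<dots> = fa_mult p (fa_mult q r) w"
    unfolding fa_mult_def f_def sum_distrib_left atLeast0AtMost
    by (intro sum.cong refl) (auto simp: mult.assoc add.commute)
  finally show "fa_mult (fa_mult p q) r w = fa_mult p (fa_mult q r) w" .
qed

lemma fa_mult_fin: "fa_mult p q \<in> fa_fin" if "p \<in> fa_fin" "q \<in> fa_fin"
proof -
  have "{w. fa_mult p q w \<noteq> 0} \<subseteq> (\<lambda>(x, y). x @ y) ` ({w. p w \<noteq> 0} \<times> {w. q w \<noteq> 0})"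
  proof
    fix w assume "w \<in> {w. fa_mult p q w \<noteq> 0}"
    then obtain i where "p (take i w) * q (drop i w) \<noteq> 0"
      unfolding fa_mult_def by (auto elim: sum.not_neutral_contains_not_neutral)
    then show "w \<in> (\<lambda>(x, y). x @ y) ` ({w. p w \<noteq> 0} \<times> {w. q w \<noteq> 0})"
      by (intro image_eqI[of _ _ "(take i w, drop i w)"]) auto
  qed
  with that show ?thesis
    unfolding fa_fin_def by (auto intro: finite_subset)
qed

lemma fa_word_fin: "fa_word u \<in> fa_fin"
  by (simp add: fa_fin_def fa_word_def)

text \<open>Making the finitely supported functions a type gives access to ring simplification and
  to the theory of spans. Results return to raw functions through \<open>coeffs\<close>.\<close>

typedef free_alg = fa_fin morphisms coeffs Abs_free_alg
  using fa_word_fin by blast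

setup_lifting type_definition_free_alg

instantiation free_alg :: ring_1
begin

lift_definition zero_free_alg :: free_alg is fa_zero
  by (simp add: fa_fin_def fa_zero_def)
lift_definition one_free_alg :: free_alg is fa_one
  by (simp add: fa_one_def fa_word_fin)
lift_definition plus_free_alg :: "free_alg \<Rightarrow> free_alg \<Rightarrow> free_alg" is fa_add
  unfolding fa_fin_def fa_add_def mem_Collect_eq
  by (erule (1) finite_subset[rotated, OF finite_UnI]) auto
lift_definition minus_free_alg :: "free_alg \<Rightarrow> free_alg \<Rightarrow> free_alg" is fa_diff
  unfolding fa_fin_def fa_diff_def mem_Collect_eq
  by (erule (1) finite_subset[rotated, OF finite_UnI]) auto
lift_definition uminus_free_alg :: "free_alg \<Rightarrow> free_alg" is "fa_smult (- 1)"
  by (simp add: fa_fin_def fa_smult_def)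
lift_definition times_free_alg :: "free_alg \<Rightarrow> free_alg \<Rightarrow> free_alg" is fa_mult
  by (rule fa_mult_fin)

instance
proof
  fix a b c :: free_alg
  show "a + b + c = a + (b + c)" "a + b = b + a" "0 + a = a" "- a + a = 0" "a - b = a + - b"
    by (transfer; simp add: fa_add_def fa_zero_def fa_smult_def fa_diff_def algebra_simps)+
  show "a * b * c = a * (b * c)"
    by transfer (rule fa_mult_assoc)
  show "1 * a = a"
  proof transfer
    fix a :: fa
    show "fa_mult fa_one a = a"
    proof
      fix w :: "gen list"
      have "fa_mult fa_one a w = (\<Sum>i\<le>length w. if i = 0 then a w else 0)"
        unfolding fa_mult_def fa_one_def fa_word_def by (intro sum.cong) auto
      then show "fa_mult fa_one a w = a w" by simp
    qed
  qed
  show "a * 1 = a"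
  proof transfer
    fix a :: fa
    show "fa_mult a fa_one = a"
    proof
      fix w :: "gen list"
      have "fa_mult a fa_one w = (\<Sum>i\<le>length w. if i = length w then a w else 0)"
        unfolding fa_mult_def fa_one_def fa_word_def by (intro sum.cong) auto
      then show "fa_mult a fa_one w = a w" by simp
    qed
  qed
  show "(a + b) * c = a * c + b * c" "a * (b + c) = a * b + a * c"
    by (transfer; simp add: fa_add_def fa_mult_def sum.distrib algebra_simps)+
  show "(0::free_alg) \<noteq> 1"
    by transfer (auto simp: fa_zero_def fa_one_def fa_word_def fun_eq_iff)
qed

end

lift_definition scal :: "rat \<Rightarrow> free_alg \<Rightarrow> free_alg" is fa_smult
  by (simp add: fa_fin_def fa_smult_def)

lift_definition wd :: "gen list \<Rightarrow> free_alg" is fa_word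
  by (rule fa_word_fin)

interpretation fa: vector_space scal
  by unfold_locales (transfer; simp add: fa_smult_def fa_add_def algebra_simps)+

lemma scal_mult [simp]: "scal c x * y = scal c (x * y)" "x * scal c y = scal c (x * y)"
  by (transfer; simp add: fa_smult_def fa_mult_def sum_distrib_left algebra_simps)+

lemma wd_append: "wd (u @ v) = wd u * wd v"
  by transfer (simp add: fa_mult_word_word)

lemma wd_Nil [simp]: "wd [] = 1"
  by transfer (simp add: fa_one_def)

lemma wd_Cons: "wd (x # u) = wd [x] * wd u"
  using wd_append[of "[x]" u] by simp

lemma wd_replicate: "wd (replicate n x) = wd [x] ^ n"
  by (induction n) (simp_all add: wd_Cons[of _ "replicate _ _"])

lemma coeffs_sum: "coeffs (sum f A) w = (\<Sum>t\<in>A. coeffs (f t) w)"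
  by (induction A rule: infinite_finite_induct)
    (simp_all add: zero_free_alg.rep_eq plus_free_alg.rep_eq fa_zero_def fa_add_def)

lemma free_alg_eq_sum_words: "x = (\<Sum>w | coeffs x w \<noteq> 0. scal (coeffs x w) (wd w))"
proof -
  have "finite {w. coeffs x w \<noteq> 0}"
    using coeffs[of x] by (simp add: fa_fin_def)
  then have "coeffs x w = coeffs (\<Sum>w | coeffs x w \<noteq> 0. scal (coeffs x w) (wd w)) w" for w
    by (simp add: coeffs_sum scal.rep_eq wd.rep_eq fa_smult_def fa_word_def if_distrib cong: if_cong)
  then show ?thesis
    by (intro coeffs_inject[THEN iffD1] ext)
qed

lemma span_words: "fa.span (range wd) = UNIV"
proof -
  have "x \<in> fa.span (range wd)" for x
    by (subst free_alg_eq_sum_words, intro fa.span_sum fa.span_scale fa.span_base) simp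
  then show ?thesis by auto
qed

lemma fa_lincomb_rep: "fa_lincomb T c (\<lambda>t. fa_word (m t)) = coeffs (\<Sum>t\<in>T. scal (c t) (wd (m t)))"
  by (auto simp: coeffs_sum fa_lincomb_def scal.rep_eq wd.rep_eq fa_smult_def)

section \<open>The ideal of relations\<close>

definition rel_ideal :: "nat \<Rightarrow> free_alg set" where
  "rel_ideal d = {x. coeffs x \<in> B_ideal d}"

lemma subspace_rel_ideal: "fa.subspace (rel_ideal d)"
  unfolding fa.subspace_def rel_ideal_def
  by (auto simp: zero_free_alg.rep_eq plus_free_alg.rep_eq scal.rep_eq intro: B_ideal.intros)

lemma rel_ideal_mult: "x \<in> rel_ideal d \<Longrightarrow> a * x * b \<in> rel_ideal d"
  unfolding rel_ideal_def
  by (auto simp: times_free_alg.rep_eq intro: B_ideal.mult coeffs)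

lemma rel_ideal_mult_left: "x \<in> rel_ideal d \<Longrightarrow> a * x \<in> rel_ideal d"
  using rel_ideal_mult[of x d a 1] by simp

lemma rel_ideal_mult_right: "x \<in> rel_ideal d \<Longrightarrow> x * a \<in> rel_ideal d"
  using rel_ideal_mult[of x d 1 a] by simp

lemma coeffs_foldr:
  "coeffs (foldr (\<lambda>k acc. (h - scal (of_nat k) 1) * acc) ks 1) =
   foldr (\<lambda>k acc. fa_mult (fa_diff (coeffs h) (fa_smult (of_nat k) fa_one)) acc) ks fa_one"
  by (induction ks)
    (simp_all add: one_free_alg.rep_eq times_free_alg.rep_eq minus_free_alg.rep_eq scal.rep_eq)

definition free_rels :: "nat \<Rightarrow> free_alg set" where
  "free_rels d = {
    wd [GH1] * wd [GH2] - wd [GH2] * wd [GH1],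
    wd [GH1] * wd [GE] - wd [GE] * wd [GH1] - wd [GE],
    wd [GH1] * wd [GF] - wd [GF] * wd [GH1] + wd [GF],
    wd [GH2] * wd [GE] - wd [GE] * wd [GH2] + wd [GE],
    wd [GH2] * wd [GF] - wd [GF] * wd [GH2] - wd [GF],
    wd [GE] * wd [GF] - wd [GF] * wd [GE] - (wd [GH1] - wd [GH2]),
    wd [GH1] + wd [GH2] - scal (of_nat d) 1,
    foldr (\<lambda>k acc. (wd [GH1] - scal (of_nat k) 1) * acc) [0..<Suc d] 1}"

lemma coeffs_free_rels: "B_rels d = coeffs ` free_rels d"
  unfolding free_rels_def image_insert image_empty coeffs_foldr
  by (simp add: B_rels_def Let_def fa_comm_def fa_gen_def wd.rep_eq
      one_free_alg.rep_eq times_free_alg.rep_eq minus_free_alg.rep_eq plus_free_alg.rep_eq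
      scal.rep_eq del: upt_Suc)

lemma relations:
  "wd [GH1] * wd [GH2] - wd [GH2] * wd [GH1] \<in> rel_ideal d"
  "wd [GH1] * wd [GE] - wd [GE] * wd [GH1] - wd [GE] \<in> rel_ideal d"
  "wd [GH1] * wd [GF] - wd [GF] * wd [GH1] + wd [GF] \<in> rel_ideal d"
  "wd [GH2] * wd [GE] - wd [GE] * wd [GH2] + wd [GE] \<in> rel_ideal d"
  "wd [GH2] * wd [GF] - wd [GF] * wd [GH2] - wd [GF] \<in> rel_ideal d"
  "wd [GE] * wd [GF] - wd [GF] * wd [GE] - (wd [GH1] - wd [GH2]) \<in> rel_ideal d"
  "wd [GH1] + wd [GH2] - scal (of_nat d) 1 \<in> rel_ideal d"
  "foldr (\<lambda>k acc. (wd [GH1] - scal (of_nat k) 1) * acc) [0..<Suc d] 1 \<in> rel_ideal d"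
  unfolding rel_ideal_def mem_Collect_eq
  by (rule B_ideal.rel, simp add: coeffs_free_rels free_rels_def del: upt_Suc)+

section \<open>The length filtration\<close>

text \<open>The preimage of F_n in the free algebra. With the ideal built in, congruences modulo the
  ideal become memberships and no quotient type is needed.\<close>

definition filt :: "nat \<Rightarrow> nat \<Rightarrow> free_alg set" where
  "filt d n = fa.span (rel_ideal d \<union> wd ` {w. length w \<le> n})"

lemma subspace_filt [simp]: "fa.subspace (filt d n)"
  by (simp add: filt_def)

lemma rel_ideal_filt: "x \<in> rel_ideal d \<Longrightarrow> x \<in> filt d n"
  unfolding filt_def by (rule fa.span_base) simp

lemma wd_filt: "length w \<le> n \<Longrightarrow> wd w \<in> filt d n"
  unfolding filt_def by (rule fa.span_base) simp

lemma filt_minimal: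
  assumes "fa.subspace V" "rel_ideal d \<subseteq> V" "\<And>w. length w \<le> n \<Longrightarrow> wd w \<in> V"
  shows "filt d n \<subseteq> V"
  unfolding filt_def using assms by (intro fa.span_minimal) auto

lemma filt_mono: "m \<le> n \<Longrightarrow> filt d m \<subseteq> filt d n"
  by (rule filt_minimal) (auto intro: rel_ideal_filt wd_filt)

lemmas filt_add = fa.subspace_add[OF subspace_filt]
  and filt_diff = fa.subspace_diff[OF subspace_filt]
  and filt_neg = fa.subspace_neg[OF subspace_filt]
  and filt_scal = fa.subspace_scale[OF subspace_filt]
  and filt_0 = fa.subspace_0[OF subspace_filt]

text \<open>Preimages of subspaces under linear maps. Together with \<open>filt_minimal\<close> they
  reduce a linear claim about a step of the filtration to the ideal and to single words.\<close>

lemma subspace_vimage_mult: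
  assumes "fa.subspace V"
  shows "fa.subspace {x. a * x * b \<in> V}"
  using assms by (simp add: fa.subspace_def distrib_left distrib_right)

lemma subspace_vimage_comm:
  assumes "fa.subspace V"
  shows "fa.subspace {x. a * x - x * a \<in> V}"
proof -
  have "a * (x + y) - (x + y) * a = (a * x - x * a) + (a * y - y * a)" for x y
    by (simp add: algebra_simps)
  then show ?thesis
    using assms by (simp add: fa.subspace_def fa.scale_right_diff_distrib[symmetric])
qed

lemma filt_mult:
  assumes "x \<in> filt d m" "y \<in> filt d n"
  shows "x * y \<in> filt d (m + n)"
proof -
  \<comment> \<open>First the left factor is a fixed word and y varies, then the left factor varies
    too. The extra factors 1 bring the sets into the shape of
    \<open>subspace_vimage_mult\<close>.\<close>
  have "filt d n \<subseteq> {y. wd w * y * 1 \<in> filt d (m + n)}" if "length w \<le> m" for w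
    using that by (intro filt_minimal subspace_vimage_mult)
      (auto simp: wd_append[symmetric] intro: rel_ideal_filt rel_ideal_mult_left wd_filt)
  then have "filt d m \<subseteq> {x. 1 * x * y \<in> filt d (m + n)}"
    using assms(2) by (intro filt_minimal subspace_vimage_mult)
      (auto intro: rel_ideal_filt rel_ideal_mult_right)
  then show ?thesis
    using assms(1) by auto
qed

lemma filt_mult3:
  assumes "x \<in> filt d m" "y \<in> filt d n" "z \<in> filt d k" "m + n + k \<le> l"
  shows "x * y * z \<in> filt d l"
  using filt_mult[OF filt_mult[OF assms(1,2)] assms(3)] filt_mono[OF assms(4)] by blast

lemma gen_power_filt: "wd [x] ^ n \<in> filt d n"
  by (simp add: wd_filt flip: wd_replicate)

lemma scal_1_filt: "scal c 1 \<in> filt d n"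
  using filt_scal[OF wd_filt[of "[]"]] by simp

text \<open>The relations rewrite a commutator, formally of degree two, in degree at most one. This
  makes the associated graded algebra commutative.\<close>

lemma gen_comm_filt: "wd [x] * wd [y] - wd [y] * wd [x] \<in> filt d 1"
proof -
  let ?c = "\<lambda>x y. wd [x] * wd [y] - wd [y] * wd [x]"
  have g: "wd [x] \<in> filt d 1" for x
    by (rule wd_filt) simp
  \<comment> \<open>These six, their negatives and zero cover all ordered pairs of
    generators.\<close>
  have c: "?c GH1 GH2 \<in> filt d 1" "?c GH1 GE \<in> filt d 1" "?c GH1 GF \<in> filt d 1"
    "?c GH2 GE \<in> filt d 1" "?c GH2 GF \<in> filt d 1" "?c GE GF \<in> filt d 1"
    using rel_ideal_filt[OF relations(1), of d 1]
      filt_add[OF rel_ideal_filt[OF relations(2)] g[of GE]]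
      filt_diff[OF rel_ideal_filt[OF relations(3)] g[of GF]]
      filt_diff[OF rel_ideal_filt[OF relations(4)] g[of GE]]
      filt_add[OF rel_ideal_filt[OF relations(5)] g[of GF]]
      filt_add[OF rel_ideal_filt[OF relations(6)] filt_diff[OF g[of GH1] g[of GH2]]]
    by simp_all
  show ?thesis
    by (cases x; cases y) (use c c[THEN filt_neg] in \<open>simp_all add: filt_0\<close>)
qed

text \<open>Commutation with a generator is a derivation that sends generators into F_1, so by the
  Leibniz rule it does not raise the degree of a word.\<close>

lemma comm_filt:
  assumes "y \<in> filt d n"
  shows "wd [x] * y - y * wd [x] \<in> filt d n"
proof -
  have words: "wd [x] * wd w - wd w * wd [x] \<in> filt d (length w)" for w
  proof (induction w)
    case Nil
    then show ?case by (simp add: filt_0)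
  next
    case (Cons y w)
    have "(wd [x] * wd [y] - wd [y] * wd [x]) * wd w \<in> filt d (1 + length w)"
      by (intro filt_mult gen_comm_filt wd_filt) simp
    moreover have "wd [y] * (wd [x] * wd w - wd w * wd [x]) \<in> filt d (1 + length w)"
      by (intro filt_mult Cons.IH wd_filt) simp
    ultimately have "(wd [x] * wd [y] - wd [y] * wd [x]) * wd w +
        wd [y] * (wd [x] * wd w - wd w * wd [x]) \<in> filt d (1 + length w)"
      by (rule filt_add)
    then show ?case
      unfolding wd_Cons[of y w] by (simp add: algebra_simps)
  qed
  have "filt d n \<subseteq> {y. wd [x] * y - y * wd [x] \<in> filt d n}"
  proof (rule filt_minimal)
    show "fa.subspace {y. wd [x] * y - y * wd [x] \<in> filt d n}"
      by (intro subspace_vimage_comm) simp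
    show "rel_ideal d \<subseteq> {y. wd [x] * y - y * wd [x] \<in> filt d n}"
      by (auto intro!: rel_ideal_filt fa.subspace_diff[OF subspace_rel_ideal]
          intro: rel_ideal_mult_left rel_ideal_mult_right)
    show "wd w \<in> {y. wd [x] * y - y * wd [x] \<in> filt d n}" if "length w \<le> n" for w
      using words[of w] filt_mono[OF that] by auto
  qed
  with assms show ?thesis by auto
qed

text \<open>The first letter of u is located in v and moved to the front. This costs a commutator
  with the prefix \<open>v1\<close>, which has lower degree, and induction compares the remaining
  letters.\<close>

lemma wd_permute_filt:
  assumes "mset u = mset v" "length u = Suc n"
  shows "wd u - wd v \<in> filt d n"
  using assms
proof (induction u arbitrary: v n)
  case (Cons x u)
  then have "x \<in> set v"
    by (metis list.set_intros(1) mset_eq_setD)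
  then obtain v1 v2 where v: "v = v1 @ x # v2"
    by (auto simp: in_set_conv_decomp)
  with Cons.prems have u: "mset u = mset (v1 @ v2)" "length u = n"
    by simp_all
  then have n: "n = length v1 + length v2"
    by (metis length_append mset_eq_length)
  have "wd [x] * (wd u - wd (v1 @ v2)) \<in> filt d n"
  proof (cases n)
    case 0
    with u n show ?thesis by (simp add: filt_0)
  next
    case (Suc m)
    have "wd [x] * (wd u - wd (v1 @ v2)) \<in> filt d (1 + m)"
      using u Suc by (intro filt_mult Cons.IH wd_filt) auto
    with Suc show ?thesis by simp
  qed
  moreover have "(wd [x] * wd v1 - wd v1 * wd [x]) * wd v2 \<in> filt d n"
    unfolding n by (intro filt_mult comm_filt wd_filt) auto
  ultimately have "wd [x] * (wd u - wd (v1 @ v2)) +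
      (wd [x] * wd v1 - wd v1 * wd [x]) * wd v2 \<in> filt d n"
    by (rule filt_add)
  then show ?case
    unfolding v wd_Cons[of x u] wd_append wd_Cons[of x v2] by (simp add: algebra_simps)
qed simp

text \<open>The letters in the order in which they appear in the two families of monomials, followed by the
  letter that is eliminated through \<open>H\<^sub>1 + H\<^sub>2 = d\<close>.\<close>
definition mirror_gens :: "(gen \<times> gen \<times> gen \<times> gen) set" where
  "mirror_gens = {(GE, GH1, GF, GH2), (GF, GH2, GE, GH1)}"

text \<open>Since g + g' is a scalar modulo the ideal, each g' can be replaced by -g up to lower
  degree; a word without g' is sorted by \<open>wd_permute_filt\<close>. The subspace V is left open
  because it will be F_d in \<open>filt_eq\<close> and a span of monomials in
  \<open>monomials_span\<close>.\<close>

lemma wd_normal_form: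
  assumes gens: "(x, g, y, g') \<in> mirror_gens"
    and V: "fa.subspace V" "filt d n \<subseteq> V"
    and mon: "\<And>a b c. a + b + c = Suc n \<Longrightarrow>
      wd (replicate a x @ replicate b g @ replicate c y) \<in> V"
    and len: "length w = Suc n"
  shows "wd w \<in> V"
  using len
proof (induction "count (mset w) g'" arbitrary: w)
  case 0
  let ?v = "replicate (count (mset w) x) x @ replicate (count (mset w) g) g @
    replicate (count (mset w) y) y"
  have "mset w = mset ?v"
  proof (rule multiset_eqI)
    fix z
    have "z \<in> {x, g, y, g'}"
      using gens by (cases z) (auto simp: mirror_gens_def)
    with 0(1) gens show "count (mset w) z = count (mset ?v) z"
      by (auto simp: mirror_gens_def)
  qed
  moreover from this have "count (mset w) x + count (mset w) g + count (mset w) y = Suc n"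
    using mset_eq_length[of w ?v] 0(2) by simp
  ultimately have "wd w - wd ?v \<in> V" "wd ?v \<in> V"
    using wd_permute_filt[of w ?v n d] 0(2) V(2) mon by blast+
  then show ?case
    using fa.subspace_add[OF V(1)] by fastforce
next
  case (Suc k)
  then have "g' \<in> set w"
    by (metis count_mset_0_iff nat.distinct(1))
  then obtain u v where w: "w = u @ g' # v"
    by (auto simp: in_set_conv_decomp)
  have "wd [g] + wd [g'] - scal (of_nat d) 1 \<in> rel_ideal d"
    using gens relations(7)[of d] by (auto simp: mirror_gens_def add.commute)
  from filt_add[OF rel_ideal_filt[OF this] scal_1_filt]
  have "wd [g] + wd [g'] \<in> filt d 0"
    by (metis diff_add_cancel)
  then have "wd u * (wd [g] + wd [g']) * wd v \<in> filt d n"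
    using Suc.prems w by (intro filt_mult3[OF wd_filt _ wd_filt]) auto
  moreover have "wd (u @ g # v) \<in> V"
    using Suc.hyps(2) Suc.prems w gens by (intro Suc.hyps(1)) (auto simp: mirror_gens_def)
  ultimately have "wd u * (wd [g] + wd [g']) * wd v - wd (u @ g # v) \<in> V"
    using V by (blast intro: fa.subspace_diff)
  then show ?case
    unfolding w wd_append wd_Cons[of _ v] by (simp add: algebra_simps)
qed

section \<open>Monomials of degree d + 1 have lower degree modulo the ideal\<close>

lemma scal_2: "scal 2 x = x + x"
  using fa.scale_left_distrib[of 1 1 x] by simp

text \<open>The Leibniz rule with only the leading term kept: z stands for [y, x] up to a scalar,
  and collecting all copies of z on the left changes only terms of lower degree.\<close>

lemma comm_power_filt:
  assumes xy: "wd [y] * wd [x] - wd [x] * wd [y] - z \<in> filt d 0" and z: "z \<in> filt d 1"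
  shows "wd [y] * wd [x] ^ Suc n - wd [x] ^ Suc n * wd [y] -
    scal (of_nat (Suc n)) (z * wd [x] ^ n) \<in> filt d n"
proof (induction n)
  case 0
  then show ?case using xy by simp
next
  case (Suc n)
  let ?x = "wd [x]" and ?y = "wd [y]"
  \<comment> \<open>\<open>?A\<close> is the error of the first commutator, \<open>?B\<close> the
    induction hypothesis times x, and \<open>?C\<close> the cost of moving z to the left of
    x.\<close>
  let ?A = "(?y * ?x - ?x * ?y - z) * ?x ^ Suc n"
  let ?B = "?x * (?y * ?x ^ Suc n - ?x ^ Suc n * ?y - scal (of_nat (Suc n)) (z * ?x ^ n))"
  let ?C = "scal (of_nat (Suc n)) ((?x * z - z * ?x) * ?x ^ n)"
  have "?A \<in> filt d (0 + Suc n)"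
    by (intro filt_mult xy gen_power_filt)
  moreover have "?B \<in> filt d (1 + n)"
    by (intro filt_mult Suc.IH wd_filt) simp
  moreover have "?C \<in> filt d (1 + n)"
    by (intro filt_scal filt_mult comm_filt z gen_power_filt)
  ultimately have "?A + ?B + ?C \<in> filt d (Suc n)"
    by (auto intro: filt_add)
  moreover have "?y * ?x ^ Suc (Suc n) - ?x ^ Suc (Suc n) * ?y -
      scal (of_nat (Suc (Suc n))) (z * ?x ^ Suc n) = ?A + ?B + ?C"
    by (simp add: algebra_simps fa.scale_left_distrib fa.scale_right_distrib
        fa.scale_right_diff_distrib scal_2)
  ultimately show ?case by simp
qed

lemma shifted_power_filt:
  "foldr (\<lambda>k acc. (wd [g] - scal (of_nat k) 1) * acc) ks 1 \<in> filt d (length ks)"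
proof (induction ks)
  case Nil
  then show ?case using wd_filt[of "[]"] by simp
next
  case (Cons k ks)
  have "wd [g] - scal (of_nat k) 1 \<in> filt d 1"
    by (intro filt_diff wd_filt scal_1_filt) simp
  from filt_mult[OF this Cons.IH] show ?case by simp
qed

lemma shifted_power_leading:
  "length ks = Suc n \<Longrightarrow>
    foldr (\<lambda>k acc. (wd [g] - scal (of_nat k) 1) * acc) ks 1 - wd [g] ^ Suc n \<in> filt d n"
proof (induction ks arbitrary: n)
  case (Cons k ks)
  let ?P = "foldr (\<lambda>k acc. (wd [g] - scal (of_nat k) 1) * acc) ks 1"
  have "wd [g] * (?P - wd [g] ^ n) \<in> filt d n"
  proof (cases n)
    case 0
    with Cons.prems show ?thesis by (simp add: filt_0)
  next
    case (Suc m)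
    have "wd [g] * (?P - wd [g] ^ n) \<in> filt d (1 + m)"
      unfolding Suc using Cons.prems Suc by (intro filt_mult Cons.IH wd_filt) auto
    with Suc show ?thesis by simp
  qed
  moreover have "scal (of_nat k) ?P \<in> filt d n"
    using shifted_power_filt[of g ks d] Cons.prems by (intro filt_scal) simp
  ultimately have "wd [g] * (?P - wd [g] ^ n) - scal (of_nat k) ?P \<in> filt d n"
    by (rule filt_diff)
  then show ?case
    by (simp add: algebra_simps)
qed simp

lemma H1_power_filt: "wd [GH1] ^ Suc d \<in> filt d d"
  using filt_diff[OF rel_ideal_filt[OF relations(8)] shifted_power_leading[of "[0..<Suc d]" d GH1 d]]
  by simp

lemma filt_scal_iff: "c \<noteq> 0 \<Longrightarrow> scal c x \<in> filt d n \<longleftrightarrow> x \<in> filt d n"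
  by (metis fa.scale_left_imp_eq fa.scale_one fa.scale_scale filt_scal left_inverse)

text \<open>Commutation with e turns one \<open>H\<^sub>1\<close> into -e: up to lower degree,
  \<open>[e, e\<^sup>aH\<^sub>1\<^sup>b\<^sup>+\<^sup>1]\<close> is -(b + 1) times the next
  monomial. The commutator lies in F_d by induction and \<open>comm_filt\<close>, and b + 1 is
  invertible in the rationals.\<close>

lemma eH_filt: "a + b = Suc d \<Longrightarrow> wd [GE] ^ a * wd [GH1] ^ b \<in> filt d d"
proof (induction a arbitrary: b)
  case 0
  then show ?case using H1_power_filt by simp
next
  case (Suc a)
  let ?e = "wd [GE]" and ?h = "wd [GH1]"
  have "?e * (?e ^ a * ?h ^ Suc b) - ?e ^ a * ?h ^ Suc b * ?e \<in> filt d d"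
    using Suc by (intro comm_filt Suc.IH) simp
  moreover have "?e ^ a * (?e * ?h ^ Suc b - ?h ^ Suc b * ?e - scal (of_nat (Suc b)) (- ?e * ?h ^ b))
      \<in> filt d (a + b)"
    using rel_ideal_filt[OF relations(2), THEN filt_neg, of d 0]
    by (intro filt_mult gen_power_filt comm_power_filt filt_neg wd_filt)
      (simp_all add: algebra_simps)
  then have "?e ^ a * (?e * ?h ^ Suc b - ?h ^ Suc b * ?e - scal (of_nat (Suc b)) (- ?e * ?h ^ b))
      \<in> filt d d"
    using Suc.prems by simp
  ultimately have "?e ^ a * (?e * ?h ^ Suc b - ?h ^ Suc b * ?e - scal (of_nat (Suc b)) (- ?e * ?h ^ b)) -
    (?e * (?e ^ a * ?h ^ Suc b) - ?e ^ a * ?h ^ Suc b * ?e) \<in> filt d d"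
    by (rule filt_diff[rotated])
  also have "?e ^ a * (?e * ?h ^ Suc b - ?h ^ Suc b * ?e - scal (of_nat (Suc b)) (- ?e * ?h ^ b)) -
    (?e * (?e ^ a * ?h ^ Suc b) - ?e ^ a * ?h ^ Suc b * ?e) =
    scal (of_nat (Suc b)) (?e ^ Suc a * ?h ^ b)"
    using power_commutes[of ?e a] by (simp add: algebra_simps flip: mult.assoc)
  finally show ?case
    by (subst (asm) filt_scal_iff) simp_all
qed

text \<open>Commutation of f with \<open>e\<^sup>aH\<^sub>1\<^sup>b\<^sup>+\<^sup>1f\<^sup>c\<close>
  has two leading parts. The part from \<open>e\<^sup>a\<close> is a multiple of
  \<open>e\<^sup>a\<^sup>-\<^sup>1H\<^sub>1\<^sup>b\<^sup>+\<^sup>2f\<^sup>c\<close>, which has the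
  same c and is covered by induction. The part from \<open>H\<^sub>1\<close> is (b + 1) times the
  wanted monomial.\<close>

lemma eHf_filt: "a + b + c = Suc d \<Longrightarrow> wd [GE] ^ a * wd [GH1] ^ b * wd [GF] ^ c \<in> filt d d"
proof (induction c arbitrary: a b)
  case 0
  then show ?case using eH_filt by simp
next
  case (Suc c)
  let ?e = "wd [GE]" and ?h = "wd [GH1]" and ?f = "wd [GF]"
  have e_part: "(?f * ?e ^ a - ?e ^ a * ?f) * ?h ^ Suc b * ?f ^ c \<in> filt d d"
  proof (cases a)
    case 0
    then show ?thesis by (simp add: filt_0)
  next
    case (Suc a')
    \<comment> \<open>Modulo the ideal, [f, e] is \<open>H\<^sub>2 - H\<^sub>1\<close>, hence d - 2
      \<open>H\<^sub>1\<close>, with leading term -2 \<open>H\<^sub>1\<close>.\<close>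
    have "?f * ?e - ?e * ?f - scal (- 2) ?h \<in> filt d 0"
    proof -
      have "- (?e * ?f - ?f * ?e - (?h - wd [GH2])) + (?h + wd [GH2] - scal (of_nat d) 1) +
          scal (of_nat d) 1 \<in> filt d 0"
        by (intro filt_add filt_neg rel_ideal_filt relations scal_1_filt)
      also have "- (?e * ?f - ?f * ?e - (?h - wd [GH2])) + (?h + wd [GH2] - scal (of_nat d) 1) +
          scal (of_nat d) 1 = ?f * ?e - ?e * ?f - scal (- 2) ?h"
        by (simp add: algebra_simps scal_2)
      finally show ?thesis .
    qed
    then have "?f * ?e ^ Suc a' - ?e ^ Suc a' * ?f - scal (of_nat (Suc a')) (scal (- 2) ?h * ?e ^ a')
        \<in> filt d a'" (is "?A \<in> _")
      by (rule comm_power_filt) (intro filt_scal wd_filt, simp)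
    then have "?A * ?h ^ Suc b * ?f ^ c \<in> filt d d"
      using Suc.prems \<open>a = Suc a'\<close> by (intro filt_mult3[OF _ gen_power_filt gen_power_filt]) auto
    moreover have "(?h * ?e ^ a' - ?e ^ a' * ?h) * ?h ^ Suc b * ?f ^ c \<in> filt d d"
      using Suc.prems \<open>a = Suc a'\<close>
      by (intro filt_mult3[OF comm_filt[OF gen_power_filt] gen_power_filt gen_power_filt]) auto
    moreover have "?e ^ a' * ?h ^ Suc (Suc b) * ?f ^ c \<in> filt d d"
      using Suc.prems \<open>a = Suc a'\<close> by (intro Suc.IH) auto
    ultimately have "?A * ?h ^ Suc b * ?f ^ c + scal (- 2 * of_nat (Suc a'))
        ((?h * ?e ^ a' - ?e ^ a' * ?h) * ?h ^ Suc b * ?f ^ c +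
          ?e ^ a' * ?h ^ Suc (Suc b) * ?f ^ c) \<in> filt d d"
      by (intro filt_add filt_scal)
    also have "?A * ?h ^ Suc b * ?f ^ c + scal (- 2 * of_nat (Suc a'))
        ((?h * ?e ^ a' - ?e ^ a' * ?h) * ?h ^ Suc b * ?f ^ c +
          ?e ^ a' * ?h ^ Suc (Suc b) * ?f ^ c) = (?f * ?e ^ a - ?e ^ a * ?f) * ?h ^ Suc b * ?f ^ c"
    proof -
      \<comment> \<open>Stated for arbitrary elements, so that the powers are not unfolded in this
        ring identity.\<close>
      have "(y - scal k (scal (- 2) ?h * u)) * v * w +
          scal (- 2 * k) ((?h * u - u * ?h) * v * w + u * (?h * v) * w) = y * v * w" for y u v w k
        by (simp add: algebra_simps fa.scale_right_diff_distrib fa.scale_right_distrib)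
      then show ?thesis
        unfolding Suc power_Suc[of ?h "Suc b"] .
    qed
    finally show ?thesis .
  qed
  have "?f * ?h - ?h * ?f - ?f \<in> filt d 0"
    using rel_ideal_filt[OF relations(3), THEN filt_neg, of d 0] by (simp add: algebra_simps)
  then have "?f * ?h ^ Suc b - ?h ^ Suc b * ?f - scal (of_nat (Suc b)) (?f * ?h ^ b) \<in> filt d b"
    (is "?B \<in> _")
    by (rule comm_power_filt) (rule wd_filt, simp)
  then have B: "?e ^ a * ?B * ?f ^ c \<in> filt d d"
    using Suc.prems by (intro filt_mult3[OF gen_power_filt _ gen_power_filt]) auto
  have H: "?e ^ a * (?f * ?h ^ b - ?h ^ b * ?f) * ?f ^ c \<in> filt d d"
    using Suc.prems
    by (intro filt_mult3[OF gen_power_filt comm_filt[OF gen_power_filt] gen_power_filt]) auto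
  have "?f * (?e ^ a * ?h ^ Suc b * ?f ^ c) - ?e ^ a * ?h ^ Suc b * ?f ^ c * ?f \<in> filt d d"
    using Suc.prems by (intro comm_filt Suc.IH) simp
  then have "?f * (?e ^ a * ?h ^ Suc b * ?f ^ c) - ?e ^ a * ?h ^ Suc b * ?f ^ c * ?f -
      (?f * ?e ^ a - ?e ^ a * ?f) * ?h ^ Suc b * ?f ^ c - ?e ^ a * ?B * ?f ^ c -
      scal (of_nat (Suc b)) (?e ^ a * (?f * ?h ^ b - ?h ^ b * ?f) * ?f ^ c) \<in> filt d d"
    by (rule filt_diff[OF filt_diff[OF filt_diff[OF _ e_part] B] filt_scal[OF H]])
  also have "?f * (?e ^ a * ?h ^ Suc b * ?f ^ c) - ?e ^ a * ?h ^ Suc b * ?f ^ c * ?f -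
      (?f * ?e ^ a - ?e ^ a * ?f) * ?h ^ Suc b * ?f ^ c - ?e ^ a * ?B * ?f ^ c -
      scal (of_nat (Suc b)) (?e ^ a * (?f * ?h ^ b - ?h ^ b * ?f) * ?f ^ c) =
      scal (of_nat (Suc b)) (?e ^ a * ?h ^ b * ?f ^ Suc c)"
    using power_commutes[of ?f c]
    by (simp del: power_Suc of_nat_Suc add: left_diff_distrib right_diff_distrib mult.assoc
        fa.scale_right_diff_distrib) (simp add: mult.assoc)
  finally show ?case
    by (subst (asm) filt_scal_iff) simp_all
qed

lemma filt_eq: "d \<le> n \<Longrightarrow> filt d n = filt d d"
proof (induction n rule: dec_induct)
  case (step n)
  have words: "wd w \<in> filt d d" if "length w = Suc d" for w
    using that by (intro wd_normal_form[where g = GH1 and g' = GH2 and x = GE and y = GF and n = d and w = w])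
      (auto simp: mirror_gens_def wd_append wd_replicate eHf_filt mult.assoc[symmetric])
  have "filt d (Suc n) \<subseteq> filt d n"
  proof (rule filt_minimal)
    fix w :: "gen list" assume w: "length w \<le> Suc n"
    show "wd w \<in> filt d n"
    proof (cases "length w = Suc n")
      case True
      \<comment> \<open>The first d + 1 letters already lie in F_d and the remaining n - d letters
        contribute n - d, so the total degree drops to n.\<close>
      have "wd (take (Suc d) w) * wd (drop (Suc d) w) \<in> filt d (d + (n - d))"
        using True step.hyps by (intro filt_mult words wd_filt) auto
      with step.hyps show ?thesis by (simp flip: wd_append)
    qed (use w in \<open>auto intro: wd_filt\<close>)
  qed (auto intro: rel_ideal_filt)
  with step.IH show ?case
    using filt_mono[of n "Suc n" d] by auto
qed simp

text \<open>By induction on n, F_n is spanned modulo the ideal by the monomials of degree at most n,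
  and F_d is everything. Although \<open>filt_eq\<close> was obtained from the first family, it
  mentions no monomials, so the mirrored family needs no commutation argument of its own.\<close>

lemma monomials_span:
  assumes gens: "(x, g, y, g') \<in> mirror_gens"
  shows "fa.span (rel_ideal d \<union>
    (\<lambda>(a, b, c). wd (replicate a x @ replicate b g @ replicate c y)) ` triples d) = UNIV"
    (is "fa.span (_ \<union> ?m ` _) = _")
proof -
  let ?V = "\<lambda>n. fa.span (rel_ideal d \<union> ?m ` triples n)"
  have I: "rel_ideal d \<subseteq> ?V n" for n
    by (auto intro: fa.span_base)
  have m: "wd (replicate a x @ replicate b g @ replicate c y) \<in> ?V n" if "a + b + c \<le> n" for a b c n
    using that by (intro fa.span_base UnI2 image_eqI[of _ _ "(a, b, c)"]) (auto simp: triples_def)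
  have "filt d n \<subseteq> ?V n" for n
  proof (induction n)
    case 0
    show ?case
      using m[of 0 0 0 0] by (intro filt_minimal I) auto
  next
    case (Suc n)
    have "?V n \<subseteq> ?V (Suc n)"
      by (intro fa.span_mono Un_mono image_mono) (auto simp: triples_def)
    with Suc have sub: "filt d n \<subseteq> ?V (Suc n)" by blast
    show ?case
    proof (intro filt_minimal I)
      fix w :: "gen list" assume w: "length w \<le> Suc n"
      show "wd w \<in> ?V (Suc n)"
      proof (cases "length w = Suc n")
        case True
        show ?thesis
          by (rule wd_normal_form[OF gens _ sub m True]) simp_all
      next
        case False
        with w have "length w \<le> n" by simp
        with sub show ?thesis
          using wd_filt by blast
      qed
    qed simp
  qed
  then have d: "filt d d \<subseteq> ?V d" .
  have "wd w \<in> filt d d" for w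
    using wd_filt[of w "max d (length w)" d] filt_eq[of d "max d (length w)"] by simp
  with d have "fa.span (range wd) \<subseteq> ?V d"
    by (intro fa.span_minimal) (blast, rule fa.subspace_span)
  then show ?thesis
    unfolding span_words by (rule top.extremum_uniqueI)
qed

section \<open>The action on tensor space\<close>

text \<open>The letter z is a parameter so that e with \<open>H\<^sub>1\<close> (z = 0) and f with
  \<open>H\<^sub>2\<close> (z = 1) are treated by the same lemmas; \<open>1 - z\<close> is the other
  letter.\<close>

definition pos :: "nat \<Rightarrow> nat list \<Rightarrow> nat set" where
  "pos z u = {i. i < length u \<and> u ! i = z}"

definition word_of :: "nat \<Rightarrow> nat \<Rightarrow> nat set \<Rightarrow> nat list" where
  "word_of d z A = map (\<lambda>i. if i \<in> A then z else 1 - z) [0..<d]"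

lemma finite_pos [simp]: "finite (pos z u)"
  by (simp add: pos_def)

lemma Wd_length: "u \<in> Wd d \<Longrightarrow> length u = d"
  by (simp add: Wd_def)

lemma Wd_nth: "u \<in> Wd d \<Longrightarrow> i < d \<Longrightarrow> u ! i = 0 \<or> u ! i = 1"
  unfolding Wd_def using nth_mem by fastforce

lemma finite_Wd [simp]: "finite (Wd d)"
  unfolding Wd_def using finite_lists_length_eq[of "{0, 1::nat}" d] by (simp add: conj_commute)

lemma pos_subset: "u \<in> Wd d \<Longrightarrow> pos z u \<subseteq> {..<d}"
  by (auto simp: pos_def Wd_length)

lemma pos_compl: "u \<in> Wd d \<Longrightarrow> z \<le> 1 \<Longrightarrow> pos (1 - z) u = {..<d} - pos z u"
proof -
  assume u: "u \<in> Wd d" and z: "z \<le> 1"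
  have "u ! i = 1 - z \<longleftrightarrow> u ! i \<noteq> z" if "i < d" for i
    using Wd_nth[OF u that] z by auto
  with u show ?thesis
    by (auto simp: pos_def Wd_length)
qed

lemma pos_inject: "u \<in> Wd d \<Longrightarrow> v \<in> Wd d \<Longrightarrow> z \<le> 1 \<Longrightarrow> pos z u = pos z v \<longleftrightarrow> u = v"
proof
  assume uv: "u \<in> Wd d" "v \<in> Wd d" "z \<le> 1" and eq: "pos z u = pos z v"
  show "u = v"
  proof (rule nth_equalityI)
    fix i assume "i < length u"
    then have "i < d" using uv by (simp add: Wd_length)
    moreover from this eq uv have "u ! i = z \<longleftrightarrow> v ! i = z"
      by (auto simp: pos_def Wd_length)
    ultimately show "u ! i = v ! i"
      using Wd_nth[of u d i] Wd_nth[of v d i] uv by (auto simp: le_Suc_eq)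
  qed (use uv in \<open>simp add: Wd_length\<close>)
qed simp

lemma word_of_Wd: "z \<le> 1 \<Longrightarrow> word_of d z A \<in> Wd d"
  by (auto simp: word_of_def Wd_def)

lemma pos_word_of: "A \<subseteq> {..<d} \<Longrightarrow> z \<le> 1 \<Longrightarrow> pos z (word_of d z A) = A"
  by (auto simp: word_of_def pos_def le_Suc_eq split: if_splits)

lemma update_Wd: "u \<in> Wd d \<Longrightarrow> z \<le> 1 \<Longrightarrow> u[i := z] \<in> Wd d"
  using set_update_subset_insert[of u i z] by (auto simp: Wd_def le_Suc_eq)

lemma pos_flip:
  assumes "i \<in> pos z u" "z \<le> 1"
  shows "pos z (u[i := 1 - z]) = pos z u - {i}" "pos (1 - z) (u[i := 1 - z]) = insert i (pos (1 - z) u)"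
proof -
  have "1 - z \<noteq> z" by arith
  then show "pos z (u[i := 1 - z]) = pos z u - {i}"
    "pos (1 - z) (u[i := 1 - z]) = insert i (pos (1 - z) u)"
    using assms by (auto simp: pos_def nth_list_update)
qed

lemma card_pos_add: "u \<in> Wd d \<Longrightarrow> card (pos 0 u) + card (pos 1 u) = d"
  using pos_compl[of u d 0] pos_subset[of u d 0] card_mono[of "{..<d}" "pos 0 u"]
  by (simp add: card_Diff_subset)

section \<open>Matrices indexed by words\<close>

definition supp_mat :: "nat \<Rightarrow> mat \<Rightarrow> bool" where
  "supp_mat d M \<longleftrightarrow> (\<forall>u v. u \<notin> Wd d \<or> v \<notin> Wd d \<longrightarrow> M u v = 0)"

lemma supp_mat_eqI:
  assumes "supp_mat d M" "supp_mat d N" "\<And>u v. u \<in> Wd d \<Longrightarrow> v \<in> Wd d \<Longrightarrow> M u v = N u v"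
  shows "M = N"
proof (intro ext)
  show "M u v = N u v" for u v
    using assms unfolding supp_mat_def by (cases "u \<in> Wd d \<and> v \<in> Wd d") metis+
qed

lemma supp_mat_mult [simp]: "supp_mat d (mat_mult d M N)"
  by (simp add: supp_mat_def mat_mult_def)

lemma supp_mat_one [simp]: "supp_mat d (mat_one d)"
  by (simp add: supp_mat_def mat_one_def)

lemma mat_mult_assoc: "mat_mult d (mat_mult d L M) N = mat_mult d L (mat_mult d M N)"
proof (rule supp_mat_eqI)
  fix u v assume uv: "u \<in> Wd d" "v \<in> Wd d"
  have "mat_mult d (mat_mult d L M) N u v = (\<Sum>w\<in>Wd d. \<Sum>t\<in>Wd d. L u t * M t w * N w v)"
    using uv by (simp add: mat_mult_def sum_distrib_right cong: sum.cong)
  also have "\<dots> = (\<Sum>t\<in>Wd d. \<Sum>w\<in>Wd d. L u t * M t w * N w v)"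
    by (rule sum.swap)
  also have "\<dots> = mat_mult d L (mat_mult d M N) u v"
    using uv by (simp add: mat_mult_def sum_distrib_left mult.assoc cong: sum.cong)
  finally show "mat_mult d (mat_mult d L M) N u v = mat_mult d L (mat_mult d M N) u v" .
qed simp_all

definition diag_mat :: "nat \<Rightarrow> (nat list \<Rightarrow> rat) \<Rightarrow> mat" where
  "diag_mat d h = (\<lambda>u v. if u \<in> Wd d \<and> v = u then h u else 0)"

lemma supp_diag_mat [simp]: "supp_mat d (diag_mat d h)"
  by (auto simp: supp_mat_def diag_mat_def)

lemma mat_mult_diag_left:
  "u \<in> Wd d \<Longrightarrow> v \<in> Wd d \<Longrightarrow> mat_mult d (diag_mat d h) M u v = h u * M u v"
  by (simp add: mat_mult_def diag_mat_def if_distrib[of "\<lambda>x. x * _"] sum.delta cong: if_cong)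

lemma mat_mult_diag_right:
  "u \<in> Wd d \<Longrightarrow> v \<in> Wd d \<Longrightarrow> mat_mult d M (diag_mat d h) u v = M u v * h v"
  by (simp add: mat_mult_def diag_mat_def if_distrib[of "\<lambda>x. _ * x"] cong: if_cong conj_cong)

lemma mat_one_diag: "mat_one d = diag_mat d (\<lambda>_. 1)"
  by (simp add: mat_one_def diag_mat_def)

lemma mat_one_left: "supp_mat d M \<Longrightarrow> mat_mult d (mat_one d) M = M"
  unfolding mat_one_diag by (rule supp_mat_eqI[where d = d]) (simp_all add: mat_mult_diag_left)

lemma mat_one_right: "supp_mat d M \<Longrightarrow> mat_mult d M (mat_one d) = M"
  unfolding mat_one_diag by (rule supp_mat_eqI[where d = d]) (simp_all add: mat_mult_diag_right)

text \<open>Rows are outputs. On tensor space this is the derivation action of the matrix unit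
  \<open>E\<^sub>1\<^sub>2\<close> for z = 0 and of \<open>E\<^sub>2\<^sub>1\<close> for z = 1;
  \<open>count_mat\<close> is that of \<open>E\<^sub>1\<^sub>1\<close> or
  \<open>E\<^sub>2\<^sub>2\<close>.\<close>

definition flip_mat :: "nat \<Rightarrow> nat \<Rightarrow> mat" where
  "flip_mat d z = (\<lambda>u v. if u \<in> Wd d then \<Sum>i\<in>pos z u. if v = u[i := 1 - z] then 1 else 0 else 0)"

definition count_mat :: "nat \<Rightarrow> nat \<Rightarrow> mat" where
  "count_mat d z = diag_mat d (\<lambda>u. of_nat (card (pos z u)))"

lemma supp_flip_mat [simp]: "supp_mat d (flip_mat d z)"
  unfolding supp_mat_def flip_mat_def using update_Wd[of _ d "1 - z"]
  by (auto intro!: sum.neutral)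

lemma mat_mult_flip:
  assumes "u \<in> Wd d" "v \<in> Wd d"
  shows "mat_mult d (flip_mat d z) M u v = (\<Sum>i\<in>pos z u. M (u[i := 1 - z]) v)"
proof -
  have "mat_mult d (flip_mat d z) M u v =
      (\<Sum>w\<in>Wd d. \<Sum>i\<in>pos z u. (if w = u[i := 1 - z] then 1 else 0) * M w v)"
    using assms by (simp add: mat_mult_def flip_mat_def sum_distrib_right)
  also have "\<dots> = (\<Sum>i\<in>pos z u. \<Sum>w\<in>Wd d. (if w = u[i := 1 - z] then 1 else 0) * M w v)"
    by (rule sum.swap)
  also have "\<dots> = (\<Sum>i\<in>pos z u. M (u[i := 1 - z]) v)"
    using assms by (simp add: update_Wd if_distrib[of "\<lambda>x. x * _"] cong: if_cong)
  finally show ?thesis .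
qed

text \<open>The shift of weight by one that yields the commutators of \<open>count_mat\<close> with
  \<open>flip_mat\<close>.\<close>

lemma flip_mat_card:
  assumes "z \<le> 1" "flip_mat d z u v \<noteq> 0"
  shows "card (pos z u) = Suc (card (pos z v))" "card (pos (1 - z) v) = Suc (card (pos (1 - z) u))"
proof -
  from assms(2) obtain i where i: "i \<in> pos z u" "v = u[i := 1 - z]"
    unfolding flip_mat_def by (auto split: if_splits elim!: sum.not_neutral_contains_not_neutral)
  show "card (pos z u) = Suc (card (pos z v))"
    using i assms(1) card_Suc_Diff1[OF finite_pos i(1)] by (simp add: pos_flip del: One_nat_def)
  have "1 - z \<noteq> z" by arith
  then have "i \<notin> pos (1 - z) u"
    using i assms(1) by (simp add: pos_def)
  then show "card (pos (1 - z) v) = Suc (card (pos (1 - z) u))"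
    using i assms(1) by (simp add: pos_flip del: One_nat_def)
qed

text \<open>Either the second flip undoes the first, which gives the diagonal part, or it acts at
  another position. The second part is symmetric in the two kinds of flips and cancels in ef -
  fe.\<close>

lemma flip_flip:
  assumes "u \<in> Wd d" "v \<in> Wd d" "z \<le> 1"
  shows "mat_mult d (flip_mat d z) (flip_mat d (1 - z)) u v = of_nat (card (pos z u)) * mat_one d u v +
    (\<Sum>i\<in>pos z u. \<Sum>j\<in>pos (1 - z) u. if v = u[i := 1 - z, j := z] then 1 else 0)"
proof -
  have "flip_mat d (1 - z) (u[i := 1 - z]) v = mat_one d u v +
      (\<Sum>j\<in>pos (1 - z) u. if v = u[i := 1 - z, j := z] then 1 else 0)" if i: "i \<in> pos z u" for i
  proof -
    have "1 - z \<noteq> z" by arith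
    then have "i \<notin> pos (1 - z) u" "u[i := z] = u"
      using i assms(3) by (auto simp: pos_def)
    then show ?thesis
      using i assms by (simp add: flip_mat_def update_Wd pos_flip mat_one_def del: One_nat_def)
  qed
  then show ?thesis
    using assms by (simp add: mat_mult_flip sum.distrib cong: sum.cong)
qed

section \<open>The representation of the free algebra and its relations\<close>

fun gen_mat :: "nat \<Rightarrow> gen \<Rightarrow> mat" where
  "gen_mat d GE = flip_mat d 0"
| "gen_mat d GF = flip_mat d 1"
| "gen_mat d GH1 = count_mat d 0"
| "gen_mat d GH2 = count_mat d 1"

lemma supp_gen_mat [simp]: "supp_mat d (gen_mat d x)"
  by (cases x) (simp_all add: count_mat_def)

fun word_mat :: "nat \<Rightarrow> gen list \<Rightarrow> mat" where
  "word_mat d [] = mat_one d"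
| "word_mat d (x # w) = mat_mult d (gen_mat d x) (word_mat d w)"

lemma supp_word_mat [simp]: "supp_mat d (word_mat d w)"
  by (cases w) simp_all

lemma word_mat_append: "word_mat d (u @ v) = mat_mult d (word_mat d u) (word_mat d v)"
  by (induction u) (simp_all add: mat_one_left mat_mult_assoc)

lemma word_mat_gen: "word_mat d [x] = gen_mat d x"
  by (simp add: mat_one_right)

definition rho :: "nat \<Rightarrow> free_alg \<Rightarrow> mat" where
  "rho d x = (\<lambda>u v. \<Sum>w | coeffs x w \<noteq> 0. coeffs x w * word_mat d w u v)"

lemma rho_superset:
  assumes "finite A" "{w. coeffs x w \<noteq> 0} \<subseteq> A"
  shows "rho d x u v = (\<Sum>w\<in>A. coeffs x w * word_mat d w u v)"
  unfolding rho_def using assms by (intro sum.mono_neutral_left) auto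

lemma finite_support: "finite {w. coeffs x w \<noteq> 0}"
  using coeffs[of x] by (simp add: fa_fin_def)

lemma rho_add: "rho d (x + y) u v = rho d x u v + rho d y u v"
proof -
  let ?A = "{w. coeffs x w \<noteq> 0} \<union> {w. coeffs y w \<noteq> 0}"
  have A: "finite ?A" by (simp add: finite_support)
  have "rho d (x + y) u v = (\<Sum>w\<in>?A. coeffs (x + y) w * word_mat d w u v)"
    by (intro rho_superset A) (auto simp: plus_free_alg.rep_eq fa_add_def)
  also have "\<dots> = (\<Sum>w\<in>?A. coeffs x w * word_mat d w u v) + (\<Sum>w\<in>?A. coeffs y w * word_mat d w u v)"
    by (simp add: plus_free_alg.rep_eq fa_add_def distrib_right sum.distrib)
  also have "\<dots> = rho d x u v + rho d y u v"
    using A by (simp add: rho_superset[where A = ?A])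
  finally show ?thesis .
qed

lemma rho_scal: "rho d (scal c x) u v = c * rho d x u v"
proof -
  have "rho d (scal c x) u v = (\<Sum>w | coeffs x w \<noteq> 0. coeffs (scal c x) w * word_mat d w u v)"
    by (intro rho_superset finite_support) (auto simp: scal.rep_eq fa_smult_def)
  then show ?thesis
    by (simp add: rho_def scal.rep_eq fa_smult_def sum_distrib_left mult.assoc)
qed

lemma rho_0: "rho d 0 u v = 0"
  using rho_scal[of d 0 0] by simp

lemma rho_diff: "rho d (x - y) u v = rho d x u v - rho d y u v"
  using rho_add[of d "x - y" y u v] by simp

lemma rho_sum: "rho d (sum f A) u v = (\<Sum>t\<in>A. rho d (f t) u v)"
  by (induction A rule: infinite_finite_induct) (simp_all add: rho_0 rho_add)

lemma rho_wd: "rho d (wd w) = word_mat d w"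
  by (intro ext) (simp add: rho_def wd.rep_eq fa_word_def cong: if_cong)

lemma rho_1: "rho d 1 = mat_one d"
  using rho_wd[of d "[]"] by simp

lemma supp_rho [simp]: "supp_mat d (rho d x)"
  using supp_word_mat unfolding rho_def supp_mat_def by (auto intro!: sum.neutral)

lemma rho_mult: "rho d (x * y) = mat_mult d (rho d x) (rho d y)"
proof -
  have "y \<in> {y. \<forall>u v. rho d (wd w * y) u v = mat_mult d (word_mat d w) (rho d y) u v}" for w y
  proof -
    have "fa.span (range wd) \<subseteq> {y. \<forall>u v. rho d (wd w * y) u v = mat_mult d (word_mat d w) (rho d y) u v}"
    proof (rule fa.span_minimal)
      show "fa.subspace {y. \<forall>u v. rho d (wd w * y) u v = mat_mult d (word_mat d w) (rho d y) u v}"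
        by (auto simp: fa.subspace_def mat_mult_def rho_0 rho_add rho_scal distrib_left
            sum.distrib sum_distrib_left mult.left_commute)
    qed (auto simp: rho_wd word_mat_append simp flip: wd_append)
    then show ?thesis unfolding span_words by blast
  qed
  then have *: "rho d (wd w * y) u v = mat_mult d (word_mat d w) (rho d y) u v" for w y u v
    by blast
  have "fa.span (range wd) \<subseteq> {x. \<forall>u v. rho d (x * y) u v = mat_mult d (rho d x) (rho d y) u v}"
  proof (rule fa.span_minimal)
    show "fa.subspace {x. \<forall>u v. rho d (x * y) u v = mat_mult d (rho d x) (rho d y) u v}"
      by (auto simp: fa.subspace_def mat_mult_def rho_0 rho_add rho_scal distrib_right
          sum.distrib sum_distrib_left mult.assoc)
  qed (auto simp: * rho_wd)
  then show ?thesis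
    unfolding span_words by (auto simp: fun_eq_iff)
qed

lemma rho_gen: "rho d (wd [x]) = gen_mat d x"
  unfolding rho_wd by (rule word_mat_gen)

lemma rho_shifted_product:
  assumes "u \<in> Wd d" "v \<in> Wd d"
  shows "rho d (foldr (\<lambda>k acc. (wd [GH1] - scal (of_nat k) 1) * acc) ks 1) u v =
    (\<Prod>k\<leftarrow>ks. of_nat (card (pos 0 u)) - of_nat k) * mat_one d u v"
proof (induction ks)
  case (Cons k ks)
  then show ?case
    using assms by (simp add: left_diff_distrib rho_diff rho_mult[of d "wd [GH1]"] rho_gen rho_scal
        count_mat_def mat_mult_diag_left)
qed (simp add: rho_1)

lemma rho_commutator:
  "rho d (wd [x] * wd [y] - wd [y] * wd [x]) u v =
    mat_mult d (gen_mat d x) (gen_mat d y) u v - mat_mult d (gen_mat d y) (gen_mat d x) u v"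
  by (simp add: rho_diff rho_mult rho_gen)

lemma rho_relations:
  assumes "r \<in> free_rels d"
  shows "rho d r u v = 0"
proof (cases "u \<in> Wd d \<and> v \<in> Wd d")
  case False
  then show ?thesis
    using supp_rho unfolding supp_mat_def by metis
next
  case True
  then have uv: "u \<in> Wd d" "v \<in> Wd d" by auto
  consider "r = wd [GH1] * wd [GH2] - wd [GH2] * wd [GH1]"
    | "r = wd [GH1] * wd [GE] - wd [GE] * wd [GH1] - wd [GE]"
    | "r = wd [GH1] * wd [GF] - wd [GF] * wd [GH1] + wd [GF]"
    | "r = wd [GH2] * wd [GE] - wd [GE] * wd [GH2] + wd [GE]"
    | "r = wd [GH2] * wd [GF] - wd [GF] * wd [GH2] - wd [GF]"
    | "r = wd [GE] * wd [GF] - wd [GF] * wd [GE] - (wd [GH1] - wd [GH2])"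
    | "r = wd [GH1] + wd [GH2] - scal (of_nat d) 1"
    | "r = foldr (\<lambda>k acc. (wd [GH1] - scal (of_nat k) 1) * acc) [0..<Suc d] 1"
    using assms unfolding free_rels_def by blast
  then show ?thesis
  proof cases
    case 1
    show ?thesis
      unfolding 1 rho_commutator using uv
      by (simp add: count_mat_def mat_mult_diag_left) (simp add: diag_mat_def)
  next
    case 2
    show ?thesis
      unfolding 2 rho_diff[of d "_ - _"] rho_commutator rho_gen using uv flip_mat_card[of 0 d u v]
      by (cases "flip_mat d 0 u v = 0")
        (simp_all add: count_mat_def mat_mult_diag_left mat_mult_diag_right algebra_simps)
  next
    case 3
    show ?thesis
      unfolding 3 rho_add rho_commutator rho_gen using uv flip_mat_card[of 1 d u v]
      by (cases "flip_mat d 1 u v = 0")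
        (simp_all add: count_mat_def mat_mult_diag_left mat_mult_diag_right algebra_simps)
  next
    case 4
    show ?thesis
      unfolding 4 rho_add rho_commutator rho_gen using uv flip_mat_card[of 0 d u v]
      by (cases "flip_mat d 0 u v = 0")
        (simp_all add: count_mat_def mat_mult_diag_left mat_mult_diag_right algebra_simps)
  next
    case 5
    show ?thesis
      unfolding 5 rho_diff[of d "_ - _"] rho_commutator rho_gen using uv flip_mat_card[of 1 d u v]
      by (cases "flip_mat d 1 u v = 0")
        (simp_all add: count_mat_def mat_mult_diag_left mat_mult_diag_right algebra_simps)
  next
    case 6
    \<comment> \<open>Flips at distinct positions commute; i and j differ because u has different
      letters there.\<close>
    have "(\<Sum>i\<in>pos 0 u. \<Sum>j\<in>pos 1 u. if v = u[i := 1, j := 0] then 1 else 0 :: rat) =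
        (\<Sum>j\<in>pos 1 u. \<Sum>i\<in>pos 0 u. if v = u[j := 0, i := 1] then 1 else 0)"
      unfolding sum.swap[of _ "pos 1 u"]
      by (intro sum.cong refl) (subst list_update_swap, auto simp: pos_def)
    then show ?thesis
      unfolding 6 rho_diff[of d "_ - _"] rho_commutator rho_gen
      using uv flip_flip[of u d v 0] flip_flip[of u d v 1]
      by (auto simp: rho_diff rho_gen count_mat_def diag_mat_def mat_one_def)
  next
    case 7
    show ?thesis
      unfolding 7 rho_diff rho_add rho_scal rho_gen rho_1 using uv card_pos_add[of u d]
      by (auto simp: count_mat_def diag_mat_def mat_one_def simp flip: of_nat_add)
  next
    case 8
    \<comment> \<open>The factor whose k is the number of zeros of u vanishes, and this k is within
      the range of the product.\<close>
    have "card (pos 0 u) \<le> d"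
      using card_pos_add[OF uv(1)] by simp
    then show ?thesis
      unfolding 8 rho_shifted_product[OF uv] by (auto simp: prod_list_zero_iff)
  qed
qed

lemma mat_zero_iff: "M = mat_zero \<longleftrightarrow> (\<forall>u v. M u v = 0)"
  by (auto simp: mat_zero_def fun_eq_iff)

text \<open>The existential also records that elements of the ideal have finite support, which is
  needed to identify the ideal with the kernel.\<close>

lemma B_ideal_rho:
  assumes "p \<in> B_ideal d"
  shows "\<exists>x. p = coeffs x \<and> rho d x = mat_zero"
  using assms
proof induction
  case (rel r)
  then show ?case
    unfolding coeffs_free_rels by (auto simp: mat_zero_iff rho_relations)
next
  case zero
  then show ?case
    by (intro exI[of _ 0]) (simp add: zero_free_alg.rep_eq mat_zero_iff rho_0)
next
  case (add p q)
  then obtain x y where "p = coeffs x" "q = coeffs y" "rho d x = mat_zero" "rho d y = mat_zero"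
    by auto
  then show ?case
    by (intro exI[of _ "x + y"]) (simp add: plus_free_alg.rep_eq mat_zero_iff rho_add)
next
  case (smult p c)
  then obtain x where "p = coeffs x" "rho d x = mat_zero"
    by auto
  then show ?case
    by (intro exI[of _ "scal c x"]) (simp add: scal.rep_eq mat_zero_iff rho_scal)
next
  case (mult p a b)
  then obtain x where "p = coeffs x" "rho d x = mat_zero"
    by auto
  with mult(2,3) show ?case
    by (intro exI[of _ "Abs_free_alg a * x * Abs_free_alg b"])
      (simp add: times_free_alg.rep_eq Abs_free_alg_inverse rho_mult mat_mult_def mat_zero_iff)
qed

lemma rho_rel_ideal: "x \<in> rel_ideal d \<Longrightarrow> rho d x = mat_zero"
  using B_ideal_rho[of "coeffs x" d] by (auto simp: rel_ideal_def coeffs_inject)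

section \<open>Matrix entries of monomials and linear independence\<close>

lemma flip_power:
  assumes "gen_mat d x = flip_mat d z" "z \<le> 1" "u \<in> Wd d" "v \<in> Wd d"
  shows "word_mat d (replicate a x) u v =
    (if pos z v \<subseteq> pos z u \<and> card (pos z u - pos z v) = a then fact a else 0)"
  using assms(3)
proof (induction a arbitrary: u)
  case 0
  have "u = v \<longleftrightarrow> pos z v \<subseteq> pos z u \<and> pos z u - pos z v = {}"
    using pos_inject[OF 0 assms(4,2)] by blast
  with 0 show ?case
    by (auto simp: mat_one_def)
next
  case (Suc a)
  \<comment> \<open>Only a first flip inside the difference of the two sets can lead from u to v.
    There are \<open>Suc a\<close> such positions, so the factorial counts the orders of the
    flips.\<close>
  have step: "word_mat d (replicate a x) (u[i := 1 - z]) v =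
      (if i \<in> pos z u - pos z v then
        if pos z v \<subseteq> pos z u \<and> card (pos z u - pos z v) = Suc a then fact a else 0 else 0)"
    if i: "i \<in> pos z u" for i
  proof -
    have "card (pos z u - {i} - pos z v) = a \<longleftrightarrow> card (pos z u - pos z v) = Suc a"
      if "i \<notin> pos z v"
    proof -
      have eq: "pos z u - {i} - pos z v = pos z u - pos z v - {i}"
        by blast
      have "Suc (card (pos z u - {i} - pos z v)) = card (pos z u - pos z v)"
        unfolding eq using i that by (intro card_Suc_Diff1) auto
      then show ?thesis
        by presburger
    qed
    then show ?thesis
      using i Suc.prems assms(2) by (auto simp: Suc.IH update_Wd pos_flip simp del: One_nat_def)
  qed
  have "word_mat d (replicate (Suc a) x) u v =
      (\<Sum>i\<in>pos z u. word_mat d (replicate a x) (u[i := 1 - z]) v)"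
    using Suc.prems assms(1,4) by (simp add: mat_mult_flip)
  also have "\<dots> = (\<Sum>i\<in>pos z u - pos z v.
      if pos z v \<subseteq> pos z u \<and> card (pos z u - pos z v) = Suc a then fact a else 0)"
    by (intro sum.mono_neutral_cong_right) (auto simp: step simp del: One_nat_def)
  finally show ?case
    by (auto simp: algebra_simps)
qed

lemma count_power:
  assumes "gen_mat d g = count_mat d z" "u \<in> Wd d" "v \<in> Wd d"
  shows "word_mat d (replicate b g @ w) u v = of_nat (card (pos z u)) ^ b * word_mat d w u v"
  by (induction b) (simp_all add: assms count_mat_def mat_mult_diag_left)

text \<open>Write U, V, W for the z-positions of u, v and of the word w between the two powers. A
  nonzero term requires W to lie in both U and V with |U - W| = a. As U - W contains U - V and a is
  at most |U - V|, the two differences agree and W is the intersection of U and V, so one term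
  \<open>w0\<close> is left.\<close>

lemma monomial_entry:
  assumes gens: "gen_mat d x = flip_mat d z" "gen_mat d g = count_mat d z"
      "gen_mat d y = flip_mat d (1 - z)" "z \<le> 1"
    and uv: "u \<in> Wd d" "v \<in> Wd d"
    and a: "a \<le> card (pos z u - pos z v)"
  shows "word_mat d (replicate a x @ replicate b g @ replicate c y) u v =
    (if a = card (pos z u - pos z v) \<and> c = card (pos z v - pos z u)
     then fact a * fact c * of_nat (card (pos z u \<inter> pos z v)) ^ b else 0)"
proof -
  define w0 where "w0 = word_of d z (pos z u \<inter> pos z v)"
  have w0: "w0 \<in> Wd d" "pos z w0 = pos z u \<inter> pos z v"
    unfolding w0_def using gens(4) pos_subset[OF uv(1), of z]
    by (simp_all add: word_of_Wd pos_word_of le_infI1 del: One_nat_def)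
  define t where "t w = word_mat d (replicate a x) u w *
    (of_nat (card (pos z w)) ^ b * word_mat d (replicate c y) w v)" for w
  have compl: "pos (1 - z) v \<subseteq> pos (1 - z) w \<longleftrightarrow> pos z w \<subseteq> pos z v"
    "pos (1 - z) w - pos (1 - z) v = pos z v - pos z w" if "w \<in> Wd d" for w
    using pos_compl[OF that gens(4)] pos_compl[OF uv(2) gens(4)] pos_subset[OF that, of z]
      pos_subset[OF uv(2), of z] by auto
  have zero: "t w = 0" if w: "w \<in> Wd d" "w \<noteq> w0" for w
  proof (rule ccontr)
    assume "t w \<noteq> 0"
    then have "pos z w \<subseteq> pos z u" "card (pos z u - pos z w) = a" "pos z w \<subseteq> pos z v"
      using w uv gens by (auto simp: t_def flip_power compl simp del: One_nat_def split: if_splits)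
    then have "pos z u - pos z w = pos z u - pos z v"
      using a by (intro card_seteq[symmetric]) auto
    with \<open>pos z w \<subseteq> pos z u\<close> \<open>pos z w \<subseteq> pos z v\<close> have "pos z w = pos z u \<inter> pos z v"
      by blast
    with w w0 gens(4) show False
      by (metis pos_inject)
  qed
  have "word_mat d (replicate a x @ replicate b g @ replicate c y) u v = (\<Sum>w\<in>Wd d. t w)"
    unfolding word_mat_append[of d "replicate a x"] t_def mat_mult_def
    using uv by (simp add: count_power[OF gens(2)])
  also have "\<dots> = t w0"
    using w0(1) zero by (subst sum.remove[of _ w0]) auto
  also have "\<dots> = (if a = card (pos z u - pos z v) \<and> c = card (pos z v - pos z u)
     then fact a * fact c * of_nat (card (pos z u \<inter> pos z v)) ^ b else 0)"
    using gens uv w0 by (simp add: t_def flip_power compl Diff_Int del: One_nat_def)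
  finally show ?thesis .
qed

lemma poly_fun_zero:
  fixes f :: "nat \<Rightarrow> rat"
  assumes "\<And>m. m \<le> n \<Longrightarrow> (\<Sum>b\<le>n. f b * of_nat m ^ b) = 0" "b \<le> n"
  shows "f b = 0"
proof -
  define p where "p = (\<Sum>b\<le>n. monom (f b) b)"
  have "p = 0"
  proof (rule poly_eqI_degree)
    show "poly p x = poly 0 x" if "x \<in> of_nat ` {..n}" for x
      using that assms(1) by (auto simp: p_def poly_sum poly_monom)
    have "degree p \<le> n"
      unfolding p_def by (intro degree_sum_le) (auto intro: order_trans[OF degree_monom_le])
    moreover have "card (of_nat ` {..n} :: rat set) = Suc n"
      by (subst card_image) (auto simp: inj_on_def)
    ultimately show "degree p < card (of_nat ` {..n} :: rat set)" "degree 0 < card (of_nat ` {..n} :: rat set)"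
      by auto
  qed
  moreover have "coeff p b = f b"
    using assms(2) by (simp add: p_def coeff_sum)
  ultimately show ?thesis by simp
qed

lemma finite_triples [simp]: "finite (triples d)"
  by (rule finite_subset[of _ "{..d} \<times> {..d} \<times> {..d}"]) (auto simp: triples_def)

lemma monomials_independent:
  assumes gens: "gen_mat d x = flip_mat d z" "gen_mat d g = count_mat d z"
      "gen_mat d y = flip_mat d (1 - z)" "z \<le> 1"
    and zero: "\<And>u v. (\<Sum>(a, b, c)\<in>triples d. k (a, b, c) *
      word_mat d (replicate a x @ replicate b g @ replicate c y) u v) = 0"
  shows "a + b + c \<le> d \<Longrightarrow> k (a, b, c) = 0"
proof (induction "d - a" arbitrary: a b c rule: less_induct)
  case less
  define n where "n = d - a - c"
  have abc: "a + n + c = d" "b \<le> n"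
    using less.prems by (auto simp: n_def)
  have IH: "k (a', b', c') = 0" if "a < a'" "a' + b' + c' \<le> d" for a' b' c'
    using that by (intro less.hyps) auto
  have "(\<Sum>b\<le>n. (k (a, b, c) * (fact a * fact c)) * of_nat m ^ b) = 0" if m: "m \<le> n" for m
  proof -
    \<comment> \<open>The two intervals have differences of sizes a and c and an intersection of
      size m; they fit below d because m is at most n.\<close>
    define u where "u = word_of d z {..<a + m}"
    define v where "v = word_of d z {a..<a + m + c}"
    have uv: "u \<in> Wd d" "v \<in> Wd d" "pos z u = {..<a + m}" "pos z v = {a..<a + m + c}"
      using gens(4) m abc by (auto simp: u_def v_def word_of_Wd intro!: pos_word_of)
    have "{..<a + m} - {a..<a + m + c} = {..<a}" "{a..<a + m + c} - {..<a + m} = {a + m..<a + m + c}"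
      "{..<a + m} \<inter> {a..<a + m + c} = {a..<a + m}"
      by auto
    then have card: "card (pos z u - pos z v) = a" "card (pos z v - pos z u) = c"
      "card (pos z u \<inter> pos z v) = m"
      by (simp_all add: uv)
    \<comment> \<open>Larger a' are killed by induction, while for a' up to a the entry is known and
      vanishes unless a' = a and c' = c. What remains is a polynomial in m of degree at most n, with
      the n + 1 roots 0, ..., n.\<close>
    have entry: "k (a', b', c') * word_mat d (replicate a' x @ replicate b' g @ replicate c' y) u v =
      (if a' = a \<and> c' = c then (k (a, b', c) * (fact a * fact c)) * of_nat m ^ b' else 0)"
      if "a' + b' + c' \<le> d" for a' b' c'
    proof (cases "a < a'")
      case True
      with IH that show ?thesis by simp
    next
      case False
      then show ?thesis
        by (subst monomial_entry[OF gens uv(1,2)]) (auto simp: card)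
    qed
    have "(\<Sum>(a', b', c')\<in>triples d. k (a', b', c') *
        word_mat d (replicate a' x @ replicate b' g @ replicate c' y) u v) =
        (\<Sum>(a', b', c')\<in>triples d. if a' = a \<and> c' = c
        then (k (a, b', c) * (fact a * fact c)) * of_nat m ^ b' else 0)"
      by (intro sum.cong refl) (auto simp: entry triples_def)
    also have "\<dots> = (\<Sum>(a', b', c')\<in>(\<lambda>b. (a, b, c)) ` {..n}. k (a, b', c) * (fact a * fact c) * of_nat m ^ b')"
      using abc by (intro sum.mono_neutral_cong_right finite_triples) (auto simp: triples_def)
    also have "\<dots> = (\<Sum>b\<le>n. (k (a, b, c) * (fact a * fact c)) * of_nat m ^ b)"
      by (subst sum.reindex) (auto simp: inj_on_def)
    finally show ?thesis
      by (simp add: zero)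
  qed
  from poly_fun_zero[OF this abc(2)] show ?case
    by simp
qed

section \<open>The image of the representation\<close>

definition mul2 :: "(nat \<Rightarrow> nat \<Rightarrow> rat) \<Rightarrow> (nat \<Rightarrow> nat \<Rightarrow> rat) \<Rightarrow> nat \<Rightarrow> nat \<Rightarrow> rat" where
  "mul2 g h = (\<lambda>i j. g i 0 * h 0 j + g i 1 * h 1 j)"

definition shear :: "nat \<Rightarrow> rat \<Rightarrow> nat \<Rightarrow> nat \<Rightarrow> rat" where
  "shear z x = (\<lambda>i j. if i = j then 1 else if i = z then x else 0)"

definition diag2 :: "nat \<Rightarrow> rat \<Rightarrow> rat \<Rightarrow> nat \<Rightarrow> nat \<Rightarrow> rat" where
  "diag2 z s t = (\<lambda>i j. if i \<noteq> j then 0 else if i = z then s else t)"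

lemma mul2_GL2: "g \<in> GL2 \<Longrightarrow> h \<in> GL2 \<Longrightarrow> mul2 g h \<in> GL2"
proof -
  assume "g \<in> GL2" "h \<in> GL2"
  moreover have "mul2 g h 0 0 * mul2 g h 1 1 - mul2 g h 0 1 * mul2 g h 1 0 =
      (g 0 0 * g 1 1 - g 0 1 * g 1 0) * (h 0 0 * h 1 1 - h 0 1 * h 1 0)"
    by (simp add: mul2_def algebra_simps)
  ultimately show ?thesis
    unfolding GL2_def mem_Collect_eq by simp
qed

lemma shear_GL2: "shear z x \<in> GL2"
  by (simp add: GL2_def shear_def)

lemma diag2_GL2: "s \<noteq> 0 \<Longrightarrow> t \<noteq> 0 \<Longrightarrow> diag2 z s t \<in> GL2"
  by (simp add: GL2_def diag2_def)

lemma supp_tensor_power [simp]: "supp_mat d (tensor_power d g)"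
  by (simp add: supp_mat_def tensor_power_def)

text \<open>Group elements are functions on all pairs of numbers, but words see only the indices 0
  and 1; matrix identities therefore need to be checked only there.\<close>

lemma tensor_power_cong:
  assumes "\<And>i j. i \<le> 1 \<Longrightarrow> j \<le> 1 \<Longrightarrow> g i j = h i j"
  shows "tensor_power d g = tensor_power d h"
proof (rule supp_mat_eqI[where d = d])
  fix u v assume uv: "u \<in> Wd d" "v \<in> Wd d"
  have "g (u ! i) (v ! i) = h (u ! i) (v ! i)" if "i < d" for i
    using Wd_nth[OF uv(1) that] Wd_nth[OF uv(2) that] by (intro assms) auto
  then show "tensor_power d g u v = tensor_power d h u v"
    by (simp add: tensor_power_def)
qed simp_all

lemma Wd_Suc: "Wd (Suc d) = Cons 0 ` Wd d \<union> Cons 1 ` Wd d"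
  by (auto simp: Wd_def length_Suc_conv image_iff)

text \<open>Expanding the product on the right chooses a letter at each position, that is, a
  word.\<close>

lemma sum_Wd_prod: "(\<Sum>w\<in>Wd d. \<Prod>i<d. F i (w ! i)) = (\<Prod>i<d. F i 0 + F i 1 :: rat)"
proof (induction d arbitrary: F)
  case 0
  have "Wd 0 = {[]}" by (auto simp: Wd_def)
  then show ?case by simp
next
  case (Suc d)
  have "(\<Sum>w\<in>Wd (Suc d). \<Prod>i<Suc d. F i (w ! i)) =
      (\<Sum>w\<in>Wd d. \<Prod>i<Suc d. F i ((0 # w) ! i)) + (\<Sum>w\<in>Wd d. \<Prod>i<Suc d. F i ((1 # w) ! i))"
    unfolding Wd_Suc by (subst sum.union_disjoint) (auto simp: sum.reindex)
  then show ?case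
    using Suc[of "\<lambda>i. F (Suc i)"]
    by (simp add: prod.lessThan_Suc_shift distrib_right del: prod.lessThan_Suc flip: sum_distrib_left)
qed

lemma tensor_power_mult:
  "mat_mult d (tensor_power d g) (tensor_power d h) = tensor_power d (mul2 g h)"
proof (rule supp_mat_eqI[where d = d])
  fix u v assume uv: "u \<in> Wd d" "v \<in> Wd d"
  have "mat_mult d (tensor_power d g) (tensor_power d h) u v =
      (\<Sum>w\<in>Wd d. \<Prod>i<d. g (u ! i) (w ! i) * h (w ! i) (v ! i))"
    using uv by (simp add: mat_mult_def tensor_power_def prod.distrib)
  also have "\<dots> = tensor_power d (mul2 g h) u v"
    using uv by (simp add: sum_Wd_prod[where F = "\<lambda>i w. g (u ! i) w * h w (v ! i)"]
        tensor_power_def mul2_def)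
  finally show "mat_mult d (tensor_power d g) (tensor_power d h) u v = tensor_power d (mul2 g h) u v" .
qed simp_all

lemma prod_indicator_power:
  "A \<subseteq> {..<d::nat} \<Longrightarrow> (\<Prod>i<d. if i \<in> A then x else 1) = (x::rat) ^ card A"
  by (subst prod.mono_neutral_cong_right[of _ A _ "\<lambda>_. x"]) auto

lemma tensor_shear:
  assumes "u \<in> Wd d" "v \<in> Wd d" "z \<le> 1"
  shows "tensor_power d (shear z x) u v =
    (if pos z v \<subseteq> pos z u then x ^ card (pos z u - pos z v) else 0)"
proof (cases "pos z v \<subseteq> pos z u")
  case True
  have "shear z x (u ! i) (v ! i) = (if i \<in> pos z u - pos z v then x else 1)" if "i < d" for i
    using True that Wd_nth[OF assms(1) that] Wd_nth[OF assms(2) that] assms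
    by (auto simp: shear_def pos_def Wd_length le_Suc_eq)
  then have "tensor_power d (shear z x) u v = (\<Prod>i<d. if i \<in> pos z u - pos z v then x else 1)"
    using assms by (simp add: tensor_power_def)
  with True pos_subset[OF assms(1)] show ?thesis
    by (subst (asm) prod_indicator_power) auto
next
  case False
  then obtain i where "i < d" "v ! i = z" "u ! i \<noteq> z"
    using assms by (auto simp: pos_def Wd_length)
  then have "\<exists>i\<in>{..<d}. shear z x (u ! i) (v ! i) = 0"
    by (intro bexI[of _ i]) (auto simp: shear_def)
  with False assms show ?thesis
    by (simp add: tensor_power_def)
qed

lemma tensor_diag:
  assumes "z \<le> 1"
  shows "tensor_power d (diag2 z s t) =
    diag_mat d (\<lambda>u. s ^ card (pos z u) * t ^ (d - card (pos z u)))"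
proof (rule supp_mat_eqI[where d = d])
  fix u v assume uv: "u \<in> Wd d" "v \<in> Wd d"
  show "tensor_power d (diag2 z s t) u v =
    diag_mat d (\<lambda>u. s ^ card (pos z u) * t ^ (d - card (pos z u))) u v"
  proof (cases "u = v")
    case True
    have "diag2 z s t (u ! i) (v ! i) =
        (if i \<in> pos z u then s else 1) * (if i \<in> {..<d} - pos z u then t else 1)" if "i < d" for i
      using True that uv by (auto simp: diag2_def pos_def Wd_length)
    then have "tensor_power d (diag2 z s t) u v =
        (\<Prod>i<d. (if i \<in> pos z u then s else 1) * (if i \<in> {..<d} - pos z u then t else 1))"
      unfolding tensor_power_def using uv by (auto intro!: prod.cong)
    also have "\<dots> = (\<Prod>i<d. if i \<in> pos z u then s else 1) * (\<Prod>i<d. if i \<in> {..<d} - pos z u then t else 1)"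
      by (rule prod.distrib)
    also have "\<dots> = s ^ card (pos z u) * t ^ card ({..<d} - pos z u)"
      using pos_subset[OF uv(1)] by (intro arg_cong2[of _ _ _ _ "(*)"] prod_indicator_power) auto
    finally show ?thesis
      using True uv pos_subset[OF uv(1), of z] by (simp add: diag_mat_def card_Diff_subset)
  next
    case False
    then obtain i where "i < d" "u ! i \<noteq> v ! i"
      using uv by (metis Wd_length nth_equalityI)
    then have "\<exists>i\<in>{..<d}. diag2 z s t (u ! i) (v ! i) = 0"
      by (intro bexI[of _ i]) (auto simp: diag2_def)
    with False uv show ?thesis
      by (auto simp: tensor_power_def diag_mat_def)
  qed
qed simp_all

section \<open>Interpolation and linear functionals on polynomials\<close>

lemma lagrange_basis:
  fixes x :: "nat \<Rightarrow> rat"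
  assumes "inj_on x {..d}"
  obtains L where "\<And>i. i \<le> d \<Longrightarrow> degree (L i) \<le> d"
    "\<And>i k. i \<le> d \<Longrightarrow> k \<le> d \<Longrightarrow> poly (L i) (x k) = (if i = k then 1 else 0)"
proof
  define L where "L i = (\<Prod>j\<in>{..d} - {i}. smult (1 / (x i - x j)) [:- x j, 1:])" for i
  show "degree (L i) \<le> d" if "i \<le> d" for i
  proof -
    have "degree (L i) \<le> (\<Sum>j\<in>{..d} - {i}. degree (smult (1 / (x i - x j)) [:- x j, 1:]))"
      unfolding L_def by (intro degree_prod_sum_le[unfolded comp_def]) simp
    also have "\<dots> \<le> (\<Sum>j\<in>{..d} - {i}. 1)"
      by (intro sum_mono) simp
    also have "\<dots> = d"
      using that by simp
    finally show ?thesis .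
  qed
  show "poly (L i) (x k) = (if i = k then 1 else 0)" if "i \<le> d" "k \<le> d" for i k
  proof (cases "i = k")
    case True
    have "x k - x j \<noteq> 0" if "j \<in> {..d} - {k}" for j
      using assms that \<open>k \<le> d\<close> by (auto simp: inj_on_def)
    with True show ?thesis
      by (auto simp: L_def poly_prod divide_simps intro!: prod.neutral)
  next
    case False
    with that show ?thesis
      by (auto simp: L_def poly_prod intro!: prod_zero bexI[of _ k])
  qed
qed

lemma interpolation:
  fixes g :: "nat \<Rightarrow> rat"
  obtains c where "\<And>n. n \<le> d \<Longrightarrow> (\<Sum>k\<le>d. c k * of_nat n ^ k) = g n"
proof -
  have "inj_on (of_nat :: nat \<Rightarrow> rat) {..d}"
    by (auto simp: inj_on_def)
  then obtain L where L: "\<And>i. i \<le> d \<Longrightarrow> degree (L i) \<le> d"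
    "\<And>i k. i \<le> d \<Longrightarrow> k \<le> d \<Longrightarrow> poly (L i) (of_nat k :: rat) = (if i = k then 1 else 0)"
    using lagrange_basis by blast
  define p where "p = (\<Sum>i\<le>d. smult (g i) (L i))"
  have "degree p \<le> d"
    unfolding p_def by (intro degree_sum_le) (auto intro: L(1))
  then have "poly p y = (\<Sum>k\<le>d. coeff p k * y ^ k)" for y
    unfolding poly_altdef by (intro sum.mono_neutral_left) (auto simp: coeff_eq_0)
  moreover have "poly p (of_nat n) = g n" if "n \<le> d" for n
    using that by (simp add: p_def poly_sum L(2) if_distrib cong: if_cong)
  ultimately show thesis
    using that[of "coeff p"] by metis
qed

text \<open>Every linear functional on polynomials of degree at most d is a combination of
  evaluations at d + 1 distinct points; g gives its values on the powers.\<close>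

lemma dual_interpolation:
  fixes x :: "nat \<Rightarrow> rat"
  assumes "inj_on x {..d}"
  obtains c where "\<And>n. n \<le> d \<Longrightarrow> (\<Sum>i\<le>d. c i * x i ^ n) = g n"
proof -
  obtain L where L: "\<And>i. i \<le> d \<Longrightarrow> degree (L i) \<le> d"
    "\<And>i k. i \<le> d \<Longrightarrow> k \<le> d \<Longrightarrow> poly (L i) (x k) = (if i = k then 1 else 0)"
    using lagrange_basis[OF assms] by blast
  \<comment> \<open>The weight at \<open>x i\<close> is the functional applied to the Lagrange
    polynomial \<open>L i\<close>; the claim follows by expanding the n-th power in the Lagrange
    basis.\<close>
  have "(\<Sum>i\<le>d. (\<Sum>k\<le>d. coeff (L i) k * g k) * x i ^ n) = g n" if n: "n \<le> d" for n
  proof -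
    have "monom 1 n = (\<Sum>i\<le>d. smult (x i ^ n) (L i))"
    proof (rule poly_eqI_degree)
      show "poly (monom 1 n) y = poly (\<Sum>i\<le>d. smult (x i ^ n) (L i)) y" if "y \<in> x ` {..d}" for y
        using that by (auto simp: poly_monom poly_sum L(2) if_distrib cong: if_cong)
      have "card (x ` {..d}) = Suc d"
        using assms by (simp add: card_image)
      moreover have "degree (\<Sum>i\<le>d. smult (x i ^ n) (L i)) \<le> d"
        by (intro degree_sum_le) (auto intro: L(1))
      moreover have "degree (monom (1::rat) n) \<le> d"
        using n by (simp add: degree_monom_eq)
      ultimately show "degree (monom (1::rat) n) < card (x ` {..d})"
        "degree (\<Sum>i\<le>d. smult (x i ^ n) (L i)) < card (x ` {..d})"
        by auto
    qed
    then have c: "(\<Sum>i\<le>d. x i ^ n * coeff (L i) k) = (if n = k then 1 else 0)" for k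
      by (metis (no_types, lifting) coeff_monom coeff_smult coeff_sum sum.cong)
    have "(\<Sum>i\<le>d. (\<Sum>k\<le>d. coeff (L i) k * g k) * x i ^ n) =
        (\<Sum>i\<le>d. \<Sum>k\<le>d. x i ^ n * coeff (L i) k * g k)"
      by (simp add: sum_distrib_right sum_distrib_left algebra_simps)
    also have "\<dots> = (\<Sum>k\<le>d. (\<Sum>i\<le>d. x i ^ n * coeff (L i) k) * g k)"
      by (subst sum.swap) (simp add: sum_distrib_right)
    also have "\<dots> = g n"
      using n by (simp add: c if_distrib[of "\<lambda>x. x * _"] cong: if_cong)
    finally show ?thesis .
  qed
  then show thesis by (rule that)
qed

section \<open>The Schur algebra as an algebra containing the generators\<close>

lemma schur_algebraI:
  assumes "finite I" "\<And>i. i \<in> I \<Longrightarrow> g i \<in> GL2"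
    and M: "\<And>u v. M u v = (\<Sum>i\<in>I. c i * tensor_power d (g i) u v)"
  shows "M \<in> schur_algebra d"
proof -
  obtain h where h: "bij_betw h {..<card I} I"
    using ex_bij_betw_nat_finite[OF assms(1)] by (auto simp: atLeast0LessThan)
  have "M u v = (\<Sum>i<card I. c (h i) * tensor_power d (g (h i)) u v)" for u v
    unfolding M by (rule sum.reindex_bij_betw[OF h, symmetric])
  moreover have "\<forall>i<card I. g (h i) \<in> GL2"
    using h assms(2) by (auto simp: bij_betw_def)
  ultimately show ?thesis
    unfolding schur_algebra_def mem_Collect_eq
    by (intro exI[of _ "card I"] exI[of _ "\<lambda>i. c (h i)"] exI[of _ "\<lambda>i. g (h i)"]) auto
qed

lemma schur_algebraE:
  assumes "M \<in> schur_algebra d"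
  obtains n :: nat and c g where "\<And>i. i < n \<Longrightarrow> g i \<in> GL2"
    "\<And>u v. M u v = (\<Sum>i<n. c i * tensor_power d (g i) u v)"
proof -
  from assms obtain n :: nat and c g where "\<forall>i<n. g i \<in> GL2"
    "M = (\<lambda>u v. \<Sum>i<n. c i * tensor_power d (g i) u v)"
    unfolding schur_algebra_def by blast
  then show thesis
    by (intro that[of n g c]) simp_all
qed

lemma schur_add_smult:
  assumes "M \<in> schur_algebra d" "N \<in> schur_algebra d"
  shows "(\<lambda>u v. k * M u v + N u v) \<in> schur_algebra d"
proof -
  obtain m b g where M: "\<And>i. i < m \<Longrightarrow> g i \<in> GL2"
    "\<And>u v. M u v = (\<Sum>i<m::nat. b i * tensor_power d (g i) u v)"
    using assms(1) by (rule schur_algebraE) blast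
  obtain n c h where N: "\<And>i. i < n \<Longrightarrow> h i \<in> GL2"
    "\<And>u v. N u v = (\<Sum>i<n::nat. c i * tensor_power d (h i) u v)"
    using assms(2) by (rule schur_algebraE) blast
  show ?thesis
    by (rule schur_algebraI[where I = "{..<m} <+> {..<n}" and c = "case_sum (\<lambda>i. k * b i) c"
          and g = "case_sum g h"])
      (auto simp: M N sum.Plus sum_distrib_left mult.assoc)
qed

lemma schur_lincomb:
  assumes "finite A" "\<And>t. t \<in> A \<Longrightarrow> N t \<in> schur_algebra d"
  shows "(\<lambda>u v. \<Sum>t\<in>A. k t * N t u v) \<in> schur_algebra d"
  using assms
proof (induction A rule: finite_induct)
  case empty
  show ?case
    by (rule schur_algebraI[where I = "{}"]) auto
next
  case (insert t A)
  then show ?case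
    by (simp add: schur_add_smult)
qed

lemma schur_tensor: "g \<in> GL2 \<Longrightarrow> tensor_power d g \<in> schur_algebra d"
  by (rule schur_algebraI[where I = "{()}" and c = "\<lambda>_. 1" and g = "\<lambda>_. g"]) auto

lemma schur_mult:
  assumes "M \<in> schur_algebra d" "N \<in> schur_algebra d"
  shows "mat_mult d M N \<in> schur_algebra d"
proof -
  obtain m b g where M: "\<And>i. i < m \<Longrightarrow> g i \<in> GL2"
    "\<And>u v. M u v = (\<Sum>i<m::nat. b i * tensor_power d (g i) u v)"
    using assms(1) by (rule schur_algebraE) blast
  obtain n c h where N: "\<And>i. i < n \<Longrightarrow> h i \<in> GL2"
    "\<And>u v. N u v = (\<Sum>i<n::nat. c i * tensor_power d (h i) u v)"
    using assms(2) by (rule schur_algebraE) blast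
  have "mat_mult d M N u v = (\<Sum>i<m. \<Sum>j<n. (b i * c j) * mat_mult d (tensor_power d (g i)) (tensor_power d (h j)) u v)"
    for u v
  proof (cases "u \<in> Wd d \<and> v \<in> Wd d")
    case True
    have "mat_mult d M N u v = (\<Sum>w\<in>Wd d. \<Sum>i<m. \<Sum>j<n.
        b i * tensor_power d (g i) u w * (c j * tensor_power d (h j) w v))"
      using True by (simp add: mat_mult_def M(2) N(2) sum_product)
    also have "\<dots> = (\<Sum>i<m. \<Sum>j<n. \<Sum>w\<in>Wd d.
        b i * tensor_power d (g i) u w * (c j * tensor_power d (h j) w v))"
      by (subst sum.swap, intro sum.cong refl sum.swap)
    also have "\<dots> = (\<Sum>i<m. \<Sum>j<n. (b i * c j) * mat_mult d (tensor_power d (g i)) (tensor_power d (h j)) u v)"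
      using True by (simp add: mat_mult_def sum_distrib_left mult_ac)
    finally show ?thesis .
  qed (auto simp: mat_mult_def)
  then show ?thesis
    by (intro schur_algebraI[where I = "{..<m} \<times> {..<n}" and c = "\<lambda>(i, j). b i * c j"
          and g = "\<lambda>(i, j). mul2 (g i) (h j)"])
      (auto simp: tensor_power_mult sum.cartesian_product case_prod_unfold intro!: mul2_GL2 M(1) N(1))
qed

lemma card_pos_le: "u \<in> Wd d \<Longrightarrow> card (pos z u) \<le> d"
  using card_mono[OF _ pos_subset] by fastforce

lemma flip_mat_gen:
  assumes "z \<le> 1"
  obtains x where "gen_mat d x = flip_mat d z"
  using assms that[of GE] that[of GF] by (cases "z = 0") (auto simp: le_Suc_eq)

lemma flip_schur:
  assumes "z \<le> 1"
  shows "flip_mat d z \<in> schur_algebra d"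
proof -
  have inj: "inj_on (of_nat :: nat \<Rightarrow> rat) {..d}"
    by (auto simp: inj_on_def)
  \<comment> \<open>The functional that extracts the coefficient of x. The entries of the shear are
    powers of x with exponent |U - V|, and exponent 1 marks the entries of
    \<open>flip_mat\<close>.\<close>
  obtain c where c: "\<And>n. n \<le> d \<Longrightarrow> (\<Sum>i\<le>d. c i * (of_nat i :: rat) ^ n) = (if n = 1 then 1 else 0)"
    using dual_interpolation[OF inj, of "\<lambda>n. if n = 1 then 1 else 0"] by blast
  obtain x where x: "gen_mat d x = flip_mat d z"
    using flip_mat_gen[OF assms] by blast
  have "flip_mat d z = (\<lambda>u v. \<Sum>i\<le>d. c i * tensor_power d (shear z (of_nat i)) u v)"
  proof (rule supp_mat_eqI[where d = d])
    show "supp_mat d (\<lambda>u v. \<Sum>i\<le>d. c i * tensor_power d (shear z (of_nat i)) u v)"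
      by (auto simp: supp_mat_def tensor_power_def)
    fix u v assume uv: "u \<in> Wd d" "v \<in> Wd d"
    have "card (pos z u - pos z v) \<le> d"
      using card_mono[of "pos z u" "pos z u - pos z v"] card_pos_le[OF uv(1), of z] by simp
    note c_card = c[OF this]
    have "flip_mat d z u v = (if pos z v \<subseteq> pos z u
        then if card (pos z u - pos z v) = 1 then 1 else 0 else 0)"
      using flip_power[OF x assms uv, of 1] by (simp add: x mat_one_right)
    also have "\<dots> = (\<Sum>i\<le>d. c i * tensor_power d (shear z (of_nat i)) u v)"
      unfolding c_card[symmetric] by (simp add: tensor_shear[OF uv assms])
    finally show "flip_mat d z u v = (\<Sum>i\<le>d. c i * tensor_power d (shear z (of_nat i)) u v)" .
  qed simp
  then show ?thesis
    by (simp add: schur_lincomb schur_tensor shear_GL2)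
qed

lemma count_schur:
  assumes "z \<le> 1"
  shows "count_mat d z \<in> schur_algebra d"
proof -
  \<comment> \<open>The nodes are 1, ..., d + 1 because diag(x, 1) must be invertible.\<close>
  have inj: "inj_on (\<lambda>i. of_nat (Suc i) :: rat) {..d}"
    by (auto simp: inj_on_def)
  \<comment> \<open>The functional is the derivative at 1: it sends the eigenvalue, x to the number
    of letters z, to that number.\<close>
  obtain c where c: "\<And>n. n \<le> d \<Longrightarrow> (\<Sum>i\<le>d. c i * (of_nat (Suc i) :: rat) ^ n) = of_nat n"
    using dual_interpolation[OF inj, of of_nat] by blast
  have "count_mat d z = (\<lambda>u v. \<Sum>i\<le>d. c i * tensor_power d (diag2 z (of_nat (Suc i)) 1) u v)"
  proof (intro ext)
    show "count_mat d z u v = (\<Sum>i\<le>d. c i * tensor_power d (diag2 z (of_nat (Suc i)) 1) u v)" for u v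
      using assms by (cases "u \<in> Wd d \<and> v = u")
        (simp_all add: count_mat_def tensor_diag diag_mat_def c card_pos_le del: of_nat_Suc, auto)
  qed
  moreover have "diag2 z (of_nat (Suc i)) 1 \<in> GL2" for i
    by (intro diag2_GL2) simp_all
  ultimately show ?thesis
    by (simp add: schur_lincomb schur_tensor del: of_nat_Suc)
qed

lemma word_mat_schur: "word_mat d w \<in> schur_algebra d"
proof (induction w)
  case Nil
  have "mat_one d = tensor_power d (diag2 0 1 1)"
    by (simp add: tensor_diag mat_one_diag)
  then show ?case
    by (simp add: schur_tensor diag2_GL2)
next
  case (Cons x w)
  have "gen_mat d x \<in> schur_algebra d"
    by (cases x) (simp_all add: flip_schur count_schur)
  with Cons show ?case
    by (simp add: schur_mult)
qed

lemma rho_schur: "rho d x \<in> schur_algebra d"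
  unfolding rho_def by (intro schur_lincomb finite_support word_mat_schur)

section \<open>Group elements in the image of the representation\<close>

lemma range_rho_shear:
  assumes "z \<le> 1"
  shows "tensor_power d (shear z x) \<in> range (rho d)"
proof -
  obtain s where s: "gen_mat d s = flip_mat d z"
    using flip_mat_gen[OF assms] by blast
  \<comment> \<open>The truncated exponential: the factorial of \<open>flip_power\<close> cancels,
    and powers beyond d do not occur since |U - V| is at most d.\<close>
  have "rho d (\<Sum>a\<le>d. scal (x ^ a / fact a) (wd (replicate a s))) = tensor_power d (shear z x)"
  proof (rule supp_mat_eqI[where d = d])
    fix u v assume uv: "u \<in> Wd d" "v \<in> Wd d"
    have "card (pos z u - pos z v) \<le> d"
      using card_mono[of "pos z u" "pos z u - pos z v"] card_pos_le[OF uv(1), of z] by simp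
    moreover have "rho d (\<Sum>a\<le>d. scal (x ^ a / fact a) (wd (replicate a s))) u v =
        (\<Sum>a\<le>d. if a = card (pos z u - pos z v) then (if pos z v \<subseteq> pos z u then x ^ a else 0) else 0)"
      unfolding rho_sum rho_scal rho_wd
      by (intro sum.cong refl) (simp add: flip_power[OF s assms uv])
    ultimately show "rho d (\<Sum>a\<le>d. scal (x ^ a / fact a) (wd (replicate a s))) u v =
        tensor_power d (shear z x) u v"
      using tensor_shear[OF uv assms] by simp
  qed simp_all
  then show ?thesis by (metis rangeI)
qed

text \<open>A diagonal group element depends only on the eigenvalue n of \<open>H\<^sub>1\<close>,
  which lies in 0, ..., d, so an interpolating polynomial in \<open>H\<^sub>1\<close> reproduces
  it.\<close>

lemma range_rho_diag: "tensor_power d (diag2 0 s t) \<in> range (rho d)"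
proof -
  obtain c where c: "\<And>n. n \<le> d \<Longrightarrow> (\<Sum>k\<le>d. c k * of_nat n ^ k) = s ^ n * t ^ (d - n)"
    using interpolation[of d "\<lambda>n. s ^ n * t ^ (d - n)"] by blast
  have "rho d (\<Sum>k\<le>d. scal (c k) (wd (replicate k GH1))) = tensor_power d (diag2 0 s t)"
  proof (rule supp_mat_eqI[where d = d])
    fix u v assume uv: "u \<in> Wd d" "v \<in> Wd d"
    have "rho d (\<Sum>k\<le>d. scal (c k) (wd (replicate k GH1))) u v =
        (\<Sum>k\<le>d. c k * of_nat (card (pos 0 u)) ^ k) * mat_one d u v"
      unfolding rho_sum rho_scal rho_wd sum_distrib_right
      using count_power[of d GH1 0 u v _ "[]"] uv by (simp add: mult.assoc)
    also have "\<dots> = tensor_power d (diag2 0 s t) u v"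
      using card_pos_le[OF uv(1)] by (simp add: c tensor_diag mat_one_def diag_mat_def)
    finally show "rho d (\<Sum>k\<le>d. scal (c k) (wd (replicate k GH1))) u v =
        tensor_power d (diag2 0 s t) u v" .
  qed simp_all
  then show ?thesis by (metis rangeI)
qed

lemma range_rho_mult:
  "tensor_power d g \<in> range (rho d) \<Longrightarrow> tensor_power d h \<in> range (rho d) \<Longrightarrow>
    tensor_power d (mul2 g h) \<in> range (rho d)"
  by (auto simp: rho_mult[symmetric] tensor_power_mult[symmetric])

lemma range_rho_tensor_big_cell:
  assumes "g 1 1 \<noteq> 0"
  shows "tensor_power d g \<in> range (rho d)"
proof -
  \<comment> \<open>Gauss factorization into upper unipotent, diagonal and lower unipotent; the
    first diagonal entry is the Schur complement of \<open>g 1 1\<close>.\<close>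
  define h where "h = mul2 (shear 0 (g 0 1 / g 1 1))
    (mul2 (diag2 0 ((g 0 0 * g 1 1 - g 0 1 * g 1 0) / g 1 1) (g 1 1)) (shear 1 (g 1 0 / g 1 1)))"
  have "tensor_power d h \<in> range (rho d)"
    unfolding h_def by (intro range_rho_mult range_rho_shear range_rho_diag) auto
  moreover have "tensor_power d g = tensor_power d h"
    using assms by (intro tensor_power_cong)
      (auto simp: h_def mul2_def shear_def diag2_def le_Suc_eq field_simps)
  ultimately show ?thesis by simp
qed

lemma range_rho_tensor:
  assumes "g \<in> GL2"
  shows "tensor_power d g \<in> range (rho d)"
proof (cases "g 1 1 = 0")
  case True
  \<comment> \<open>If \<open>g 1 1\<close> is 0, invertibility forces \<open>g 0 1\<close> to be
    nonzero, and adding row 0 to row 1 moves it into the corner.\<close>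
  with assms have "mul2 (shear 1 1) g 1 1 \<noteq> 0"
    by (auto simp: GL2_def mul2_def shear_def)
  then have "tensor_power d (mul2 (shear 1 (- 1)) (mul2 (shear 1 1) g)) \<in> range (rho d)"
    by (intro range_rho_mult range_rho_shear range_rho_tensor_big_cell) auto
  moreover have "tensor_power d g = tensor_power d (mul2 (shear 1 (- 1)) (mul2 (shear 1 1) g))"
    by (intro tensor_power_cong) (auto simp: mul2_def shear_def le_Suc_eq)
  ultimately show ?thesis by simp
qed (rule range_rho_tensor_big_cell)

lemma range_rho: "range (rho d) = schur_algebra d"
proof
  show "range (rho d) \<subseteq> schur_algebra d"
    by (auto simp: rho_schur)
  show "schur_algebra d \<subseteq> range (rho d)"
  proof
    fix M assume "M \<in> schur_algebra d"
    then obtain n c g where M: "\<And>i. i < n \<Longrightarrow> g i \<in> GL2"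
      "\<And>u v. M u v = (\<Sum>i<n::nat. c i * tensor_power d (g i) u v)"
      by (rule schur_algebraE) blast
    have "\<forall>i\<in>{..<n}. \<exists>y. tensor_power d (g i) = rho d y"
      using range_rho_tensor[OF M(1)] by blast
    then obtain y where "\<And>i. i < n \<Longrightarrow> tensor_power d (g i) = rho d (y i)"
      by (metis lessThan_iff)
    then have "M = rho d (\<Sum>i<n. scal (c i) (y i))"
      by (auto simp: fun_eq_iff M(2) rho_sum rho_scal)
    then show "M \<in> range (rho d)" by simp
  qed
qed

section \<open>Bases, kernel and isomorphism\<close>

lemma rel_ideal_complement:
  assumes "fa.span (rel_ideal d \<union> f ` T) = UNIV" "finite T"
  shows "\<exists>k. x - (\<Sum>t\<in>T. scal (k t) (f t)) \<in> rel_ideal d"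
proof -
  let ?V = "{x. \<exists>k. x - (\<Sum>t\<in>T. scal (k t) (f t)) \<in> rel_ideal d}"
  note sub = subspace_rel_ideal[of d]
  have "fa.span (rel_ideal d \<union> f ` T) \<subseteq> ?V"
  proof (rule fa.span_minimal)
    show "rel_ideal d \<union> f ` T \<subseteq> ?V"
    proof (intro Un_least subsetI)
      show "x \<in> ?V" if "x \<in> rel_ideal d" for x
        using that by (auto intro!: exI[of _ "\<lambda>_. 0"])
      show "x \<in> ?V" if "x \<in> f ` T" for x
      proof -
        obtain s where s: "s \<in> T" "x = f s" using \<open>x \<in> f ` T\<close> by auto
        have "(\<Sum>t\<in>T. scal (if t = s then 1 else 0) (f t)) = (\<Sum>t\<in>T. if t = s then f t else 0)"
          by (intro sum.cong) auto
        with s assms(2) fa.subspace_0[OF sub] show ?thesis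
          by (auto intro!: exI[of _ "\<lambda>t. if t = s then 1 else 0"])
      qed
    qed
    show "fa.subspace ?V"
      unfolding fa.subspace_def
    proof (intro conjI ballI allI)
      show "0 \<in> ?V"
        using fa.subspace_0[OF sub] by (auto intro!: exI[of _ "\<lambda>_. 0"])
    next
      fix x y assume "x \<in> ?V" "y \<in> ?V"
      then obtain k l where "x - (\<Sum>t\<in>T. scal (k t) (f t)) \<in> rel_ideal d"
        "y - (\<Sum>t\<in>T. scal (l t) (f t)) \<in> rel_ideal d" by auto
      from fa.subspace_add[OF sub this] show "x + y \<in> ?V"
        by (auto intro!: exI[of _ "\<lambda>t. k t + l t"] simp: fa.scale_left_distrib sum.distrib algebra_simps)
    next
      fix c x assume "x \<in> ?V"
      then obtain k where "x - (\<Sum>t\<in>T. scal (k t) (f t)) \<in> rel_ideal d" by auto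
      from fa.subspace_scale[OF sub this, of c] show "scal c x \<in> ?V"
        by (auto intro!: exI[of _ "\<lambda>t. c * k t"] simp: fa.scale_right_diff_distrib fa.scale_sum_right)
    qed
  qed
  with assms(1) show ?thesis by auto
qed

text \<open>Independence after applying \<open>rho\<close> serves twice: a combination in the ideal
  acts as zero and is trivial, and an x acting as zero is congruent to a combination that acts as
  zero, hence lies in the ideal.\<close>

lemma quot_basisI:
  assumes span: "fa.span (rel_ideal d \<union> (\<lambda>t. wd (m t)) ` T) = UNIV" "finite T"
    and indep: "\<And>k. (\<And>u v. (\<Sum>t\<in>T. k t * word_mat d (m t) u v) = 0) \<Longrightarrow> \<forall>t\<in>T. k t = 0"
  shows "quot_basis d T m" "rho d x = mat_zero \<Longrightarrow> x \<in> rel_ideal d"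
proof -
  have indep': "\<forall>t\<in>T. k t = 0" if "rho d (\<Sum>t\<in>T. scal (k t) (wd (m t))) = mat_zero" for k
    using that by (intro indep) (simp add: mat_zero_iff rho_sum rho_scal rho_wd)
  show "quot_basis d T m"
    unfolding quot_basis_def fa_lincomb_rep
  proof (intro conjI ballI allI impI)
    fix p :: fa assume "p \<in> fa_fin"
    then obtain x where p: "p = coeffs x"
      by (metis Abs_free_alg_inverse)
    show "\<exists>c. fa_diff p (coeffs (\<Sum>t\<in>T. scal (c t) (wd (m t)))) \<in> B_ideal d"
      using rel_ideal_complement[OF span, of x]
      unfolding p rel_ideal_def mem_Collect_eq minus_free_alg.rep_eq .
  next
    fix c t assume c: "coeffs (\<Sum>t\<in>T. scal (c t) (wd (m t))) \<in> B_ideal d" and t: "t \<in> T"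
    from c have "rho d (\<Sum>t\<in>T. scal (c t) (wd (m t))) = mat_zero"
      by (intro rho_rel_ideal) (simp add: rel_ideal_def)
    from indep'[OF this] t show "c t = 0"
      by blast
  qed
  assume x: "rho d x = mat_zero"
  obtain k where k: "x - (\<Sum>t\<in>T. scal (k t) (wd (m t))) \<in> rel_ideal d" (is "x - ?s \<in> _")
    using rel_ideal_complement[OF span] by blast
  have "rho d (x - ?s) u v = 0" "rho d x u v = 0" for u v
    using rho_rel_ideal[OF k] x by (simp_all add: mat_zero_def)
  then have "rho d ?s = mat_zero"
    by (simp add: mat_zero_iff rho_diff)
  from indep'[OF this] k show "x \<in> rel_ideal d"
    by simp
qed

lemma PBW_basis:
  assumes "(x, g, y, g') \<in> mirror_gens"
    and m: "\<And>a b c. m (a, b, c) = replicate a x @ replicate b g @ replicate c y"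
  shows "quot_basis d (triples d) m" "rho d p = mat_zero \<Longrightarrow> p \<in> rel_ideal d"
proof -
  have span: "fa.span (rel_ideal d \<union> (\<lambda>t. wd (m t)) ` triples d) = UNIV"
    using monomials_span[OF assms(1), of d] by (simp add: m[symmetric] case_prod_unfold)
  obtain z where z: "gen_mat d x = flip_mat d z" "gen_mat d g = count_mat d z"
      "gen_mat d y = flip_mat d (1 - z)" "z \<le> 1"
  proof (cases "x = GE")
    case True
    with assms(1) show thesis by (intro that[of 0]) (auto simp: mirror_gens_def)
  next
    case False
    with assms(1) show thesis by (intro that[of 1]) (auto simp: mirror_gens_def)
  qed
  have indep: "\<forall>t\<in>triples d. k t = 0" if "\<And>u v. (\<Sum>t\<in>triples d. k t * word_mat d (m t) u v) = 0" for k
    using monomials_independent[OF z, where k = k] that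
    by (simp add: triples_def case_prod_unfold flip: m)
  show "quot_basis d (triples d) m" "rho d p = mat_zero \<Longrightarrow> p \<in> rel_ideal d"
    using quot_basisI[OF span finite_triples indep] by blast+
qed

theorem theorem5p2:
  fixes d :: nat
  shows "B_iso_schur d \<and> quot_basis d (triples d) mon_eHf \<and> quot_basis d (triples d) mon_fHe"
proof (intro conjI)
  have eHf: "(GE, GH1, GF, GH2) \<in> mirror_gens" "(GF, GH2, GE, GH1) \<in> mirror_gens"
    by (auto simp: mirror_gens_def)
  show "quot_basis d (triples d) mon_eHf" "quot_basis d (triples d) mon_fHe"
    by (rule PBW_basis[OF eHf(1)] PBW_basis[OF eHf(2)]; simp add: mon_eHf_def mon_fHe_def)+
  have ker: "rho d x = mat_zero \<longleftrightarrow> coeffs x \<in> B_ideal d" for x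
    using PBW_basis(2)[OF eHf(1), of mon_eHf d x] rho_rel_ideal[of x d]
    by (auto simp: mon_eHf_def rel_ideal_def)
  have fin: "B_ideal d \<subseteq> fa_fin"
    using B_ideal_rho coeffs by blast
  \<comment> \<open>Values outside \<open>fa_fin\<close> are unspecified; all clauses to be shown
    concern arguments in \<open>fa_fin\<close> only.\<close>
  define phi where "phi p = rho d (Abs_free_alg p)" for p
  have phi: "phi (coeffs x) = rho d x" for x
    by (simp add: phi_def coeffs_inverse)
  have fa_fin: "fa_fin = range coeffs"
    using type_definition.Rep_range[OF type_definition_free_alg] by simp
  have "alg_hom d phi"
    unfolding alg_hom_def fa_fin
    by (auto simp: phi rho_mult rho_1 mat_add_def mat_smult_def fun_eq_iff rho_add rho_scal
      simp flip: plus_free_alg.rep_eq times_free_alg.rep_eq scal.rep_eq one_free_alg.rep_eq)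
  moreover have "{p \<in> fa_fin. phi p = mat_zero} = B_ideal d"
    using fin by (auto simp: fa_fin phi ker)
  moreover have "phi ` fa_fin = schur_algebra d"
    by (auto simp: fa_fin phi image_image range_rho[symmetric])
  ultimately show "B_iso_schur d"
    unfolding B_iso_schur_def by blast
qed

end
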